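(* Let $q$ be a power of $2$ and let $\mathcal{H}$ be a monomial hyperoval of $\mathbf{PG}(2,q)$ which is not a translation hyperoval. Then the elementary abelian translation group (of order $q^3$) of the affine space $\mathbf{PG}(3,q)\setminus\mathbf{PG}(2,q)$ is the only linear Singer group of the generalized quadrangle $\mathbf{T}_2^*(\mathcal{H})$.
   Context: A hyperoval of $\mathbf{PG}(2,q)$, $q$ even, is a set of $q+2$ points no three of which are collinear. It is monomial if it is projectively equivalent to $\{(1,t,t^m) : t\in\mathbb{F}_q\}\cup\{(0,1,0),(0,0,1)\}$ for some $m$, and it is a translation hyperoval if it is equivalent to such a hyperoval with $m=2^k$, $\gcd(k,h)=1$, $q=2^h$. For a hyperoval $\mathcal{H}$ in $\mathbf{PG}(2,q)\subset\mathbf{PG}(3,q)$, $\mathbf{T}_2^*(\mathcal{H})$ is the generalized quadrangle of order $(q-1,q+1)$ whose points are the points of $\mathbf{PG}(3,q)\setminus\mathbf{PG}(2,q)$ and whose lines are the lines of $\mathbf{PG}(3,q)$ meeting $\mathbf{PG}(2,q)$ exactly in a point of $\mathcal{H}$. A Singer group is a group of automorphisms acting sharply transitively on the points; it is linear if it is induced by a subgroup of $\mathbf{PGL}_4(q)$ (stabilizing $\mathbf{PG}(2,q)$ and $\mathcal{H}$). *)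

theory Defs
  imports "HOL-Analysis.Analysis" "HOL-Algebra.Bij"
begin

text \<open>
  Points, lines and planes of a projective space are the vector subspaces of dimension 1, 2, 3
  of the underlying coordinate space; incidence is inclusion.
\<close>

definition proj_points :: "('a::field ^ 'n) set set" where
  "proj_points = {U. vec.subspace U \<and> vec.dim U = 1}"

definition proj_lines :: "('a::field ^ 'n) set set" where
  "proj_lines = {U. vec.subspace U \<and> vec.dim U = 2}"

definition proj_planes :: "('a::field ^ 'n) set set" where
  "proj_planes = {U. vec.subspace U \<and> vec.dim U = 3}"

text \<open>
  Groups of collineations are subgroups of the library's \<^const>\<open>BijGroup\<close>, whose elements are
  extensional functions.
\<close>

definition PGL :: "(('a::field ^ 'n) set \<Rightarrow> ('a ^ 'n) set) set" where
  "PGL = {(\<lambda>U\<in>proj_points. f ` U) | f. Vector_Spaces.linear (*s) (*s) f \<and> bij f}"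

definition hyperoval :: "('a::{field,finite} ^ 4) set \<Rightarrow> ('a ^ 4) set set \<Rightarrow> bool" where
  "hyperoval W H \<longleftrightarrow>
     H \<subseteq> {p \<in> proj_points. p \<subseteq> W} \<and> card H = CARD('a) + 2 \<and>
     (\<forall>p\<in>H. \<forall>r\<in>H. \<forall>s\<in>H. p \<noteq> r \<and> p \<noteq> s \<and> r \<noteq> s \<longrightarrow>
        \<not> (\<exists>l\<in>proj_lines. p \<subseteq> l \<and> r \<subseteq> l \<and> s \<subseteq> l))"

definition monomial_set :: "nat \<Rightarrow> ('a::field ^ 3) set set" where
  "monomial_set m =
     {vec.span {vector [1, t, t ^ m]} | t. True} \<union>
     {vec.span {vector [0, 1, 0]}, vec.span {vector [0, 0, 1]}}"

text \<open>
  The plane \<open>W\<close> of the 3-space is identified with the coordinate plane by a projectivity.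
  Allowing semilinear maps would not change the next two notions, since \<open>monomial_set m\<close> is
  invariant under all field automorphisms.
\<close>

definition proj_equivalent :: "('a::field ^ 4) set \<Rightarrow> ('a ^ 4) set set \<Rightarrow> ('a ^ 3) set set \<Rightarrow> bool" where
  "proj_equivalent W H K \<longleftrightarrow>
     (\<exists>f. Vector_Spaces.linear (*s) (*s) f \<and> inj f \<and> range f = W \<and> H = (\<lambda>U. f ` U) ` K)"

definition monomial_hyperoval :: "('a::{field,finite} ^ 4) set \<Rightarrow> ('a ^ 4) set set \<Rightarrow> bool" where
  "monomial_hyperoval W H \<longleftrightarrow> hyperoval W H \<and> (\<exists>m. proj_equivalent W H (monomial_set m))"

definition translation_hyperoval :: "('a::{field,finite} ^ 4) set \<Rightarrow> ('a ^ 4) set set \<Rightarrow> bool" where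
  "translation_hyperoval W H \<longleftrightarrow> hyperoval W H \<and>
     (\<exists>h k. CARD('a) = 2 ^ h \<and> coprime k h \<and> proj_equivalent W H (monomial_set (2 ^ k)))"

definition affine_points :: "('a::field ^ 4) set \<Rightarrow> ('a ^ 4) set set" where
  "affine_points W = {p \<in> proj_points. \<not> p \<subseteq> W}"

text \<open>
  A line of \<open>T\<^sub>2\<^sup>*(H)\<close> is represented by the set of its affine points; as there are at least two of
  them, this determines the line. The condition \<open>l \<inter> W \<in> H\<close> says that \<open>l\<close> meets the plane \<open>W\<close>
  exactly in one point, which belongs to \<open>H\<close>.
\<close>

definition T2star_lines :: "('a::field ^ 4) set \<Rightarrow> ('a ^ 4) set set \<Rightarrow> ('a ^ 4) set set set" where
  "T2star_lines W H =
     {{p \<in> affine_points W. p \<subseteq> l} | l. l \<in> proj_lines \<and> l \<inter> W \<in> H}"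

definition geometry_automorphisms :: "'p set \<Rightarrow> 'p set set \<Rightarrow> ('p \<Rightarrow> 'p) set" where
  "geometry_automorphisms P L = {g \<in> Bij P. (\<lambda>l. g ` l) ` L = L}"

definition sharply_transitive :: "('p \<Rightarrow> 'p) set \<Rightarrow> 'p set \<Rightarrow> bool" where
  "sharply_transitive G P \<longleftrightarrow> (\<forall>x\<in>P. \<forall>y\<in>P. \<exists>!g. g \<in> G \<and> g x = y)"

definition singer_group :: "'p set \<Rightarrow> 'p set set \<Rightarrow> ('p \<Rightarrow> 'p) set \<Rightarrow> bool" where
  "singer_group P L G \<longleftrightarrow>
     subgroup G (BijGroup P) \<and> G \<subseteq> geometry_automorphisms P L \<and> sharply_transitive G P"

definition linear_singer_group ::
  "('a::field ^ 4) set \<Rightarrow> ('a ^ 4) set set \<Rightarrow> (('a ^ 4) set \<Rightarrow> ('a ^ 4) set) set \<Rightarrow> bool" where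
  "linear_singer_group W H G \<longleftrightarrow>
     singer_group (affine_points W) (T2star_lines W H) G \<and>
     (\<exists>K. subgroup K (BijGroup proj_points) \<and> K \<subseteq> PGL \<and>
        (\<forall>g\<in>K. g ` {p \<in> proj_points. p \<subseteq> W} = {p \<in> proj_points. p \<subseteq> W} \<and> g ` H = H) \<and>
        G = (\<lambda>g. restrict g (affine_points W)) ` K)"

text \<open>
  If \<open>W\<close> is the plane \<open>X\<^sub>0 = 0\<close>, the maps \<open>f\<close> below are \<open>(X\<^sub>0, X) \<mapsto> (X\<^sub>0, X + X\<^sub>0 v)\<close>, which induce
  \<open>X \<mapsto> X + v\<close> on the affine points \<open>(1, X)\<close>.
\<close>

definition translation_group :: "('a::field ^ 4) set \<Rightarrow> (('a ^ 4) set \<Rightarrow> ('a ^ 4) set) set" where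
  "translation_group W =
     {(\<lambda>p\<in>affine_points W. f ` p) | f.
        Vector_Spaces.linear (*s) (*s) f \<and> (\<forall>w\<in>W. f w = w) \<and> (\<forall>x. f x - x \<in> W)}"

definition elementary_abelian :: "nat \<Rightarrow> ('g, 'b) monoid_scheme \<Rightarrow> bool" where
  "elementary_abelian p G \<longleftrightarrow>
     prime p \<and> comm_group G \<and> (\<forall>x\<in>carrier G. x [^]\<^bsub>G\<^esub> p = \<one>\<^bsub>G\<^esub>)"

end

theory Submission
  imports Defs "HOL-Algebra.Multiplicative_Group" "HOL-Combinatorics.Cycles"
    "HOL-Computational_Algebra.Polynomial"
begin

text \<open>
  An element \<open>g\<close> of a linear Singer group \<open>G\<close> comes from a linear map \<open>f\<close> that fixes the plane at
  infinity and the hyperoval \<open>H\<close>. As \<open>G\<close> has order \<open>q\<^sup>3\<close>, a power of 2, \<open>f\<close> induces a permutation of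
  \<open>H\<close> of 2-power order. If no linear collineation induces an involution on \<open>H\<close>, then \<open>f\<close> fixes \<open>H\<close>
  pointwise, hence is scalar on the plane, and its remaining eigenvalue is the same scalar because
  \<open>x \<mapsto> x ^ q\<^sup>3\<close> is the identity of the field: \<open>g\<close> is a translation.

  So let \<open>H\<close> be monomial, with its three special points \<open>(1,0,0)\<close>, \<open>(0,1,0)\<close>, \<open>(0,0,1)\<close>, and suppose
  that there is a linear involution on \<open>H\<close>. The cyclic group of diagonal collineations is regular on
  the remaining \<open>q - 1\<close> points of \<open>H\<close>. A parity argument with this group produces an involution
  fixing a special point, and conjugating by a diagonal collineation one may assume that it either
  swaps the other two special points or fixes one of them. In the first case \<open>t ^ m = 1 / t\<close>, so that
  \<open>m\<close> may be replaced by 2 after a permutation of the coordinates; in the second case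
  \<open>t \<mapsto> t ^ m\<close> is additive for a suitable order of the coordinates. Additive monomials are
  powers of the Frobenius automorphism, so \<open>H\<close> is a translation hyperoval.
\<close>

section \<open>Power maps on finite fields\<close>

text \<open>Multiplication by \<open>x\<close> permutes the nonzero elements, so it multiplies their
  product by \<open>x ^ (CARD('a) - 1)\<close> and also leaves it unchanged.\<close>

lemma finite_field_power_card_minus_1:
  fixes x :: "'a::{field,finite}"
  assumes "x \<noteq> 0"
  shows "x ^ (CARD('a) - 1) = 1"
proof -
  let ?U = "UNIV - {0::'a}"
  have "bij_betw ((*) x) ?U ?U"
    by (rule bij_betwI[where g = "\<lambda>y. y / x"]) (use assms in auto)
  then have "\<Prod>?U = (\<Prod>y\<in>?U. x * y)"
    by (rule prod.reindex_bij_betw[symmetric, where g = "\<lambda>y. y"])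
  also have "\<dots> = x ^ (CARD('a) - 1) * \<Prod>?U"
    by (simp add: prod.distrib card_Diff_singleton)
  finally show ?thesis
    by simp
qed

lemma card_field_ge_2: "CARD('a::{field,finite}) \<ge> 2"
  using card_mono[of UNIV "{0::'a, 1}"] by simp

lemma finite_field_power_card_minus_2:
  fixes x :: "'a::{field,finite}"
  assumes "x \<noteq> 0"
  shows "x ^ (CARD('a) - 2) = inverse x"
proof -
  have "x * x ^ (CARD('a) - 2) = x ^ (CARD('a) - 1)"
    using card_field_ge_2[where 'a='a] by (metis Suc_diff_Suc Suc_1 Suc_le_lessD power_Suc)
  then show ?thesis
    using finite_field_power_card_minus_1[OF assms] assms by (simp add: inverse_unique)
qed

lemma finite_field_power_card:
  fixes x :: "'a::{field,finite}"
  shows "x ^ CARD('a) = x"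
proof (cases "x = 0")
  case False
  have "x ^ CARD('a) = x * x ^ (CARD('a) - 1)"
    using card_field_ge_2[where 'a='a] by (metis power_minus_mult mult.commute zero_less_card_finite)
  then show ?thesis
    using finite_field_power_card_minus_1[OF False] by simp
qed (simp add: zero_power zero_less_card_finite)

lemma finite_field_power_card_power:
  fixes x :: "'a::{field,finite}"
  shows "x ^ (CARD('a) ^ n) = x"
  by (induction n) (simp_all add: power_mult finite_field_power_card)

text \<open>Adding 1 permutes the field, so the sum of all elements does not change when
  \<open>of_nat CARD('a)\<close> is added to it. Hence \<open>2 ^ h\<close>, and with it 2, vanishes
  in the field.\<close>

lemma char_2:
  assumes "CARD('a::{field,finite}) = 2 ^ h"
  shows "(2::'a) = 0"
proof -
  have "(\<Sum>x\<in>UNIV. x + 1) = (\<Sum>x\<in>UNIV. x::'a)"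
    by (rule sum.reindex_bij_witness[of _ "\<lambda>x. x - 1" "\<lambda>x. x + 1"]) auto
  then have "of_nat CARD('a) = (0::'a)"
    by (simp add: sum.distrib)
  then have "(2::'a) ^ h = 0"
    using assms by simp
  then show ?thesis
    by simp
qed

lemma char_2_add_self: "(2::'a::field) = 0 \<Longrightarrow> x + x = (0::'a)"
  by (metis mult_2 mult_zero_left)

lemma char_2_uminus: "(2::'a::field) = 0 \<Longrightarrow> - x = (x::'a)"
  by (metis char_2_add_self minus_unique)

lemma frobenius_add:
  fixes x y :: "'a::field"
  assumes "(2::'a) = 0"
  shows "(x + y) ^ 2 ^ k = x ^ 2 ^ k + y ^ 2 ^ k"
proof (induction k)
  case (Suc k)
  have sq: "(a + b)\<^sup>2 = a\<^sup>2 + b\<^sup>2" for a b :: 'a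
    by (simp add: power2_sum assms)
  have "(x + y) ^ 2 ^ Suc k = ((x + y) ^ 2 ^ k)\<^sup>2"
    by (simp add: power_mult mult.commute flip: power_mult)
  also have "\<dots> = x ^ 2 ^ Suc k + y ^ 2 ^ Suc k"
    by (simp add: Suc sq mult.commute flip: power_mult)
  finally show ?case .
qed simp

lemma frobenius_inject:
  fixes x y :: "'a::field"
  assumes "(2::'a) = 0" "x ^ 2 ^ k = y ^ 2 ^ k"
  shows "x = y"
proof -
  have "(x + y) ^ 2 ^ k = 0"
    using assms by (simp add: frobenius_add char_2_add_self)
  then have "x + y = 0"
    by simp
  then show ?thesis
    by (metis assms(1) char_2_uminus eq_neg_iff_add_eq_0)
qed

text \<open>Every field element is a root of (1 + X)^n - 1 - X^n, whose degree is below n because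
  the leading terms cancel. For odd n at least 2 the coefficient of X is n = 1 in characteristic 2,
  so this nonzero polynomial would have more roots than its degree allows.\<close>

lemma additive_odd_power:
  assumes "(2::'a::{field,finite}) = 0" "odd n" "n < CARD('a)"
    and add: "\<And>t::'a. (1 + t) ^ n = 1 + t ^ n"
  shows "n = 1"
proof (rule ccontr)
  assume "n \<noteq> 1"
  with \<open>odd n\<close> have n: "n \<ge> 2"
    by (cases n) auto
  define p :: "'a poly" where "p = [:1, 1:] ^ n - 1 - Polynomial.monom 1 n"
  have c: "Polynomial.coeff ([:1, 1::'a:] ^ n) i = of_nat (n choose i)" if "i \<le> n" for i
    using that by (simp add: coeff_linear_poly_power)
  have "of_nat n = (1::'a)"
    using \<open>odd n\<close> assms(1) by (elim oddE) simp
  then have "Polynomial.coeff p 1 = 1"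
    using n c[of 1] by (simp add: p_def)
  then have "p \<noteq> 0"
    by auto
  have "degree p \<le> n"
    unfolding p_def by (intro degree_diff_le degree_monom_le order.trans[OF degree_power_le]) auto
  moreover have "Polynomial.coeff p n = 0"
    using n c[of n] by (simp add: p_def)
  ultimately have "degree p < n"
    using \<open>p \<noteq> 0\<close> n by (metis eq_zero_or_degree_less)
  moreover have "{x. poly p x = 0} = UNIV"
    using add by (auto simp: p_def poly_monom)
  ultimately show False
    using card_poly_roots_bound[OF \<open>p \<noteq> 0\<close>] assms(3) by simp
qed

text \<open>Once the exponent is reduced modulo q - 1, its factor \<open>2 ^ k\<close> is split off.
  Injectivity of the Frobenius power passes additivity on to the odd part \<open>n\<close>, which
  must then be 1.\<close>

lemma additive_power_eq_frobenius:
  assumes two: "(2::'a::{field,finite}) = 0" and "m > 0"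
    and add: "\<And>t::'a. (1 + t) ^ m = 1 + t ^ m"
  obtains k where "\<And>t::'a. t ^ m = t ^ 2 ^ k"
proof -
  \<comment> \<open>The representative is chosen between 1 and q - 1, not between 0 and q - 2, so
    that \<open>t ^ m = t ^ r\<close> also holds for \<open>t = 0\<close>.\<close>
  define r where "r = (m - 1) mod (CARD('a) - 1) + 1"
  have q: "CARD('a) - 1 > 0"
    using card_field_ge_2[where 'a='a] by simp
  have r: "t ^ m = t ^ r" for t :: 'a
  proof (cases "t = 0")
    case False
    have "t ^ (m - 1) = t ^ ((CARD('a) - 1) * ((m - 1) div (CARD('a) - 1)) + (m - 1) mod (CARD('a) - 1))"
      by simp
    also have "\<dots> = t ^ ((m - 1) mod (CARD('a) - 1))"
      unfolding power_add power_mult finite_field_power_card_minus_1[OF False] by simp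
    finally have "t * t ^ (m - 1) = t ^ r"
      by (simp add: r_def)
    then show ?thesis
      using \<open>m > 0\<close> by (simp add: power_eq_if)
  qed (use \<open>m > 0\<close> in \<open>simp add: r_def\<close>)
  have "r > 0" and "r < CARD('a)"
    unfolding r_def using q mod_less_divisor[OF q, of "m - 1"] by linarith+
  obtain k n where kn: "r = 2 ^ k * n" "odd n"
    using \<open>r > 0\<close> multiplicity_decompose'[of r 2] by (metis nat_neq_iff odd_one)
  have "(1 + t) ^ n = 1 + t ^ n" for t :: 'a
  proof (rule frobenius_inject[OF two])
    have "((1 + t) ^ n) ^ 2 ^ k = (1 + t) ^ m"
      by (simp add: r kn mult.commute flip: power_mult)
    also have "\<dots> = (1 + t ^ n) ^ 2 ^ k"
      by (simp add: add frobenius_add[OF two]) (simp add: r kn mult.commute flip: power_mult)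
    finally show "((1 + t) ^ n) ^ 2 ^ k = (1 + t ^ n) ^ 2 ^ k" .
  qed
  moreover have "n < CARD('a)"
    using \<open>r < CARD('a)\<close> kn by (metis le_less_trans
        nat_dvd_not_less not_less dvd_triv_right \<open>r > 0\<close> leI)
  ultimately have "n = 1"
    using additive_odd_power two kn(2) by blast
  then show thesis
    using that[of k] r kn by simp
qed

lemma exists_power_neq_1:
  assumes "0 < n" "n < CARD('a::{field,finite}) - 1"
  obtains a :: "'a::{field,finite}" where "a \<noteq> 0" "a ^ n \<noteq> 1"
proof -
  define p :: "'a poly" where "p = Polynomial.monom 1 n - 1"
  have "Polynomial.coeff p n = 1"
    using assms by (simp add: p_def)
  then have "p \<noteq> 0"
    by auto
  have "degree p \<le> n"
    unfolding p_def by (intro degree_diff_le degree_monom_le) auto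
  then have "card {x. poly p x = 0} < card (UNIV - {0::'a})"
    using card_poly_roots_bound[OF \<open>p \<noteq> 0\<close>] assms by (simp add: card_Diff_singleton)
  then have "\<not> UNIV - {0} \<subseteq> {x. poly p x = 0}"
    by (meson card_mono finite not_less)
  then show thesis
    using that by (auto simp: p_def poly_monom)
qed

text \<open>For \<open>d = gcd k h\<close> the number \<open>2 ^ d - 1\<close> divides both q - 1
  and \<open>2 ^ k - 1\<close>. If \<open>d \<ge> 2\<close>, some power with exponent (q - 1) / (2^d
  - 1) differs from 1, yet raising it to \<open>2 ^ k - 1\<close> gives 1.\<close>

lemma coprime_of_inj_power:
  assumes q: "CARD('a::{field,finite}) = 2 ^ h"
    and inj: "\<And>t::'a. t \<noteq> 0 \<Longrightarrow> t ^ (2 ^ k - 1) = 1 \<Longrightarrow> t = 1"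
  shows "coprime k h"
proof -
  define d where "d = gcd k h"
  have "h > 0"
    using q card_field_ge_2[where 'a='a] by (cases h) auto
  have dvd: "(2::nat) ^ d - 1 dvd 2 ^ i - 1" if "d dvd i" for i
  proof -
    from that obtain j where "i = d * j" ..
    moreover have "(2::int) ^ d - 1 dvd (2 ^ d) ^ j - 1"
      by (simp add: power_diff_1_eq)
    moreover have "int (2 ^ n - 1) = 2 ^ n - 1" for n
      by (simp add: of_nat_diff)
    ultimately show ?thesis
      by (metis int_dvd_int_iff power_mult)
  qed
  have "d = 1"
  proof (rule ccontr)
    assume "d \<noteq> 1"
    then have "d \<ge> 2"
      using \<open>h > 0\<close> unfolding d_def by (metis One_nat_def Suc_1 Suc_leI gcd_pos_nat nat_less_le)
    then have e: "(2::nat) ^ d - 1 > 1"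
      using power_increasing[OF \<open>d \<ge> 2\<close>, of "2::nat"] by simp
    obtain n where n: "CARD('a) - 1 = (2 ^ d - 1) * n"
      using dvd[of h] q unfolding d_def by auto
    have "n > 0"
      using n card_field_ge_2[where 'a='a] by (cases n) auto
    moreover have "n < CARD('a) - 1"
      using n e \<open>n > 0\<close> by simp
    ultimately obtain a :: 'a where a: "a \<noteq> 0" "a ^ n \<noteq> 1"
      using exists_power_neq_1 by blast
    obtain j where j: "2 ^ k - 1 = ((2::nat) ^ d - 1) * j"
      using dvd[of k] unfolding d_def by auto
    have "(a ^ n) ^ (2 ^ k - 1) = (a ^ (CARD('a) - 1)) ^ j"
      by (simp only: n j mult.commute mult.left_commute flip: power_mult)
    also have "\<dots> = 1"
      by (simp only: finite_field_power_card_minus_1[OF a(1)] power_one)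
    finally have "a ^ n = 1"
      using inj[of "a ^ n"] a(1) by simp
    with a(2) show False ..
  qed
  then show ?thesis
    by (simp add: d_def coprime_iff_gcd_eq_1)
qed

section \<open>Linear permutations of an arc\<close>

text \<open>An involution is a product of disjoint transpositions. The induction splits off one of
  them, which removes two moved points and changes the sign.\<close>

lemma involution_sign:
  assumes "finite A" "p permutes A" "p \<circ> p = id"
  shows "\<exists>n. card {x. p x \<noteq> x} = 2 * n \<and> sign p = (- 1) ^ n"
  using assms(2,3)
proof (induction "card {x. p x \<noteq> x}" arbitrary: p rule: less_induct)
  case less
  have fin: "finite {x. p x \<noteq> x}"
    using less.prems(1) \<open>finite A\<close> by (metis (mono_tags, lifting) finite_subset mem_Collect_eq permutes_not_in subsetI)
  show ?case
  proof (cases "p = id")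
    case True
    then show ?thesis
      by (intro exI[of _ 0]) simp
  next
    case False
    then obtain a where a: "p a \<noteq> a"
      by (auto simp: fun_eq_iff)
    define b where "b = p a"
    have pp: "p (p x) = x" for x
      using less.prems(2) by (metis comp_apply id_apply)
    define p' where "p' = Transposition.transpose a b \<circ> p"
    have p': "p' x = (if x = a \<or> x = b then x else p x)" for x
    proof -
      have "p x = a \<longleftrightarrow> x = b" "p x = b \<longleftrightarrow> x = a"
        unfolding b_def by (metis pp)+
      then show ?thesis
        using a by (auto simp: p'_def b_def Transposition.transpose_def)
    qed
    have ab: "a \<in> A" "b \<in> A"
      using a less.prems(1) pp unfolding b_def by (metis permutes_not_in)+
    have "p' permutes A"
      unfolding p'_def using ab less.prems(1) by (intro permutes_compose permutes_swap_id)
    have "p' \<circ> p' = id"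
      using pp by (auto simp: fun_eq_iff p' b_def) metis+
    have m: "{x. p' x \<noteq> x} = {x. p x \<noteq> x} - {a, b}"
      by (auto simp: p')
    have "{a, b} \<subseteq> {x. p x \<noteq> x}" "card {a, b} = 2"
      using a pp by (auto simp: b_def)
    then have c: "card {x. p x \<noteq> x} = card {x. p' x \<noteq> x} + 2"
      using card_Diff_subset[of "{a, b}" "{x. p x \<noteq> x}"] card_mono[OF fin, of "{a, b}"]
      unfolding m by simp
    then obtain n where n: "card {x. p' x \<noteq> x} = 2 * n" "sign p' = (- 1) ^ n"
      using less.hyps[of p'] \<open>p' permutes A\<close> \<open>p' \<circ> p' = id\<close> by auto
    have "permutation p" "permutation (Transposition.transpose a b)"
      unfolding permutation_permutes using less.prems(1) \<open>finite A\<close> permutes_swap_id[OF ab] by blast+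
    then have "sign p' = - sign p"
      unfolding p'_def using a by (simp add: sign_compose sign_swap_id b_def)
    then show ?thesis
      using n c by (intro exI[of _ "Suc n"]) simp
  qed
qed

text \<open>The points that are not fixed fall into pairs. Extending \<open>f\<close> by the
  identity off \<open>A\<close> gives a permutation to which \<open>involution_sign\<close>
  applies.\<close>

lemma even_card_involution_iff:
  assumes "finite A" "\<And>x. x \<in> A \<Longrightarrow> f x \<in> A" "\<And>x. x \<in> A \<Longrightarrow> f (f x) = x"
  shows "even (card A) \<longleftrightarrow> even (card {x \<in> A. f x = x})"
proof -
  define p where "p x = (if x \<in> A then f x else x)" for x
  have "p \<circ> p = id"
    using assms by (auto simp: p_def fun_eq_iff)
  moreover from this have "p permutes A"
    by (auto simp: permutes_def p_def) (metis comp_apply id_apply p_def)+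
  ultimately obtain n where "card {x. p x \<noteq> x} = 2 * n"
    using involution_sign[OF assms(1)] by blast
  moreover have "card A = card {x \<in> A. f x = x} + card {x. p x \<noteq> x}"
    using assms(1) by (subst card_Un_disjoint[symmetric]) (auto simp: p_def intro!: arg_cong[of _ _ card] split: if_splits)
  ultimately show ?thesis
    by simp
qed

text \<open>\<open>inv\<close> is claimed by the structure syntax of HOL-Algebra.\<close>

abbreviation perm_inv :: "('p \<Rightarrow> 'p) \<Rightarrow> 'p \<Rightarrow> 'p" where
  "perm_inv \<equiv> inv_into UNIV"

section \<open>Linear maps, points and independent triples\<close>

abbreviation linmap :: "(('a::field) ^ 'n \<Rightarrow> 'a ^ 'm) \<Rightarrow> bool" where
  "linmap \<equiv> Vector_Spaces.linear (*s) (*s)"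

lemma linmap_iff:
  "linmap f \<longleftrightarrow> (\<forall>x y. f (x + y) = f x + f y) \<and> (\<forall>c x. f (c *s x) = c *s f x)"
  by (simp add: Vector_Spaces.linear_iff vec.vector_space_axioms)

lemma linmapD:
  assumes "linmap f"
  shows "f (x + y) = f x + f y" "f (c *s x) = c *s f x"
  using assms by (auto simp: linmap_iff)

lemma linmap_compose: "linmap f \<Longrightarrow> linmap g \<Longrightarrow> linmap (\<lambda>x. f (g x))"
  by (simp add: linmap_iff)

lemma linmap_funpow:
  fixes f :: "'a::field ^ 'n \<Rightarrow> 'a ^ 'n"
  shows "linmap f \<Longrightarrow> linmap (f ^^ n)"
  by (induction n) (simp_all add: linmap_iff)

text \<open>The point with homogeneous coordinate vector \<open>x\<close>; \<open>pt 0\<close> is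
  the zero subspace, which is not a projective point.\<close>

definition pt :: "('a::field) ^ 'n \<Rightarrow> ('a ^ 'n) set" where
  "pt x = vec.span {x}"

lemma mem_pt_iff: "y \<in> pt x \<longleftrightarrow> (\<exists>c. y = c *s x)"
  by (auto simp: pt_def vec.span_singleton)

lemma self_mem_pt: "x \<in> pt x"
  by (simp add: pt_def vec.span_base)

lemma pt_scale: "c \<noteq> 0 \<Longrightarrow> pt (c *s x) = pt x"
  unfolding set_eq_iff mem_pt_iff by (metis vector_smult_assoc nonzero_eq_divide_eq)

lemma pt_eq_iff: "pt x = pt y \<longleftrightarrow> (\<exists>c. c \<noteq> 0 \<and> x = c *s y)"
proof
  assume eq: "pt x = pt y"
  then obtain c where c: "x = c *s y"
    using self_mem_pt mem_pt_iff by metis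
  show "\<exists>c. c \<noteq> 0 \<and> x = c *s y"
  proof (cases "c = 0")
    case True
    then have "y = 0"
      using c eq self_mem_pt[of y] by (auto simp: mem_pt_iff)
    then show ?thesis
      using c by (intro exI[of _ 1]) simp
  qed (use c in blast)
qed (auto simp: pt_scale)

lemma pt_subset_iff: "vec.subspace U \<Longrightarrow> pt x \<subseteq> U \<longleftrightarrow> x \<in> U"
  by (metis pt_def self_mem_pt subsetD vec.span_minimal empty_subsetI insert_subset)

lemma proj_points_iff: "U \<in> proj_points \<longleftrightarrow> (\<exists>x. x \<noteq> 0 \<and> U = pt x)"
proof
  assume "U \<in> proj_points"
  then have U: "vec.subspace U" "vec.dim U = 1"
    by (auto simp: proj_points_def)
  then obtain B where B: "B \<subseteq> U" "vec.independent B" "U \<subseteq> vec.span B" "card B = 1"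
    using vec.basis_exists[of U] by metis
  then obtain x where "B = {x}"
    using card_1_singletonE by blast
  with B U show "\<exists>x. x \<noteq> 0 \<and> U = pt x"
    unfolding pt_def using vec.dependent_single vec.span_minimal by blast
next
  assume "\<exists>x. x \<noteq> 0 \<and> U = pt x"
  then show "U \<in> proj_points"
    unfolding proj_points_def pt_def
    by (auto simp: vec.dim_span vec.dim_eq_card_independent vec.dependent_single)
qed

lemma pt_in_proj_points_iff: "pt x \<in> proj_points \<longleftrightarrow> x \<noteq> 0"
proof
  assume "pt x \<in> proj_points"
  then show "x \<noteq> 0"
    by (auto simp: proj_points_iff pt_eq_iff)
qed (auto simp: proj_points_iff)

lemma linmap_pt: "linmap f \<Longrightarrow> f ` pt x = pt (f x)"
  unfolding set_eq_iff image_iff Bex_def mem_pt_iff by (metis linmapD(2))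

lemma linmap_pt_fixedE:
  assumes "linmap f" "f ` pt x = pt y"
  obtains c where "c \<noteq> 0" "f x = c *s y"
  using assms by (metis linmap_pt pt_eq_iff)

text \<open>Independence of a triple, stated by coefficients: it also excludes repeated vectors,
  which independence of the set \<open>{x, y, z}\<close> would admit.\<close>

definition indep3 :: "('a::field) ^ 'n \<Rightarrow> 'a ^ 'n \<Rightarrow> 'a ^ 'n \<Rightarrow> bool" where
  "indep3 x y z \<longleftrightarrow> (\<forall>a b c. a *s x + b *s y + c *s z = 0 \<longrightarrow> a = 0 \<and> b = 0 \<and> c = 0)"

lemma indep3D:
  assumes "indep3 x y z" "a *s x + b *s y + c *s z = 0"
  shows "a = 0" "b = 0" "c = 0"
  using assms unfolding indep3_def by blast+

lemma indep3_eqD: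
  assumes "indep3 x y z" "a *s x + b *s y + c *s z = a' *s x + b' *s y + c' *s z"
  shows "a = a'" "b = b'" "c = c'"
proof -
  have "(a - a') *s x + (b - b') *s y + (c - c') *s z = 0"
    using assms(2) by (simp add: vec_eq_iff algebra_simps)
  then show "a = a'" "b = b'" "c = c'"
    using indep3D[OF assms(1)] right_minus_eq by blast+
qed

lemma indep3_swap12: "indep3 x y z \<Longrightarrow> indep3 y x z"
  unfolding indep3_def by (metis add.commute)

lemma indep3_swap23: "indep3 x y z \<Longrightarrow> indep3 x z y"
  unfolding indep3_def add.assoc by (metis add.commute)

lemma mem_span_pair: "z \<in> vec.span {x, y} \<longleftrightarrow> (\<exists>a b. z = a *s x + b *s y)"
  unfolding vec.span_breakdown_eq[of z x] vec.span_singleton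
  by (force simp: diff_eq_eq add.commute image_iff)

lemma indep3_independent:
  assumes "indep3 x y z"
  shows "vec.independent {x, y, z}" "card {x, y, z} = 3"
proof -
  have z: "z \<noteq> 0"
    using indep3D(3)[OF assms, of 0 0 1] by auto
  have yz: "y \<notin> vec.span {z}"
    using indep3D(2)[OF assms, of 0 1] by (force simp: vec.span_singleton add_eq_0_iff simp flip: vec.scale_minus_left)
  have x: "x \<notin> vec.span {y, z}"
  proof
    assume "x \<in> vec.span {y, z}"
    then obtain a b where "x = a *s y + b *s z"
      by (auto simp: mem_span_pair)
    then have "1 *s x + (- a) *s y + (- b) *s z = 0"
      by (simp add: vec_eq_iff)
    then show False
      using indep3D(1)[OF assms] by fastforce
  qed
  show "vec.independent {x, y, z}"
    using z yz x by (simp add: vec.independent_insert vec.dependent_single)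
  show "card {x, y, z} = 3"
    using yz x by (auto simp: card_insert_if vec.span_base)
qed

lemma indep3_span:
  fixes x y z :: "'a::field ^ 'n"
  assumes "indep3 x y z" "x \<in> W" "y \<in> W" "z \<in> W" "vec.dim W = 3" "s \<in> W"
  obtains a b c where "s = a *s x + b *s y + c *s z"
proof -
  have "W \<subseteq> vec.span {x, y, z}"
    using assms indep3_independent[OF assms(1)]
    by (intro vec.card_ge_dim_independent) auto
  then have "s \<in> vec.span {x, y, z}"
    using assms(6) by auto
  then obtain a where "s - a *s x \<in> vec.span {y, z}"
    by (auto simp: vec.span_breakdown_eq[of s x])
  then obtain b c where "s - a *s x = b *s y + c *s z"
    by (auto simp: mem_span_pair)
  then have "s = a *s x + b *s y + c *s z"
    by (simp add: algebra_simps)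
  then show thesis ..
qed

section \<open>Arcs and the linear maps that preserve them\<close>

locale arc_in_plane =
  fixes W :: "('a::{field,finite} ^ 4) set" and H :: "('a ^ 4) set set"
  assumes subspace_W: "vec.subspace W" and dim_W: "vec.dim W = 3"
    and points: "H \<subseteq> {p \<in> proj_points. p \<subseteq> W}"
    and arc: "\<And>p r s. p \<in> H \<Longrightarrow> r \<in> H \<Longrightarrow> s \<in> H \<Longrightarrow> p \<noteq> r \<Longrightarrow> p \<noteq> s \<Longrightarrow> r \<noteq> s \<Longrightarrow>
      \<not> (\<exists>l\<in>proj_lines. p \<subseteq> l \<and> r \<subseteq> l \<and> s \<subseteq> l)"
begin

lemma finite_H [simp]: "finite H"
  by simp

lemma H_cases:
  assumes "p \<in> H"
  obtains x where "p = pt x" "x \<in> W" "x \<noteq> 0"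
proof -
  have "p \<in> proj_points" "p \<subseteq> W"
    using assms points by auto
  then show thesis
    using that by (auto simp: proj_points_iff pt_subset_iff[OF subspace_W])
qed

lemma ptH_D: "pt x \<in> H \<Longrightarrow> x \<in> W" "pt x \<in> H \<Longrightarrow> x \<noteq> 0"
  using points pt_in_proj_points_iff self_mem_pt by blast+

text \<open>Otherwise the three points would lie on the line \<open>vec.span {x, y}\<close>.\<close>

lemma not_combination:
  assumes "pt x \<in> H" "pt y \<in> H" "pt z \<in> H" "pt x \<noteq> pt y" "pt x \<noteq> pt z" "pt y \<noteq> pt z"
  shows "z \<noteq> a *s x + b *s y"
proof
  assume z: "z = a *s x + b *s y"
  have nz: "x \<noteq> 0" "y \<noteq> 0"
    using assms ptH_D by blast+
  have "x \<notin> vec.span {y}"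
    using assms(4) nz pt_eq_iff by (force simp: vec.span_singleton)
  then have "vec.independent {x, y}" "card {x, y} = 2"
    using nz by (auto simp: vec.independent_insert vec.dependent_single card_insert_if vec.span_base)
  then have "vec.span {x, y} \<in> proj_lines"
    unfolding proj_lines_def by (simp add: vec.dim_span vec.dim_eq_card_independent)
  moreover have "pt x \<subseteq> vec.span {x, y}" "pt y \<subseteq> vec.span {x, y}" "pt z \<subseteq> vec.span {x, y}"
    unfolding pt_subset_iff[OF vec.subspace_span] by (auto simp: vec.span_base) (auto simp: mem_span_pair z)
  ultimately show False
    using arc[of "pt x" "pt y" "pt z"] assms by blast
qed

text \<open>A relation with a nonzero coefficient could be solved for the corresponding vector,
  against \<open>not_combination\<close>.\<close>

lemma arc_indep3:
  assumes "pt x \<in> H" "pt y \<in> H" "pt z \<in> H" "pt x \<noteq> pt y" "pt x \<noteq> pt z" "pt y \<noteq> pt z"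
  shows "indep3 x y z"
  unfolding indep3_def
proof (intro allI impI)
  fix a b c
  assume eq: "a *s x + b *s y + c *s z = 0"
  have solve: "t = (- r / s) *s r' + (- k / s) *s s'"
    if "r *s r' + k *s s' + s *s t = 0" "s \<noteq> 0" for r k s and r' s' t :: "'a ^ 4"
  proof -
    have "s *s t = - (r *s r' + k *s s')"
      by (metis that(1) add.commute eq_neg_iff_add_eq_0)
    then have "(1 / s) *s (s *s t) = (1 / s) *s (- (r *s r' + k *s s'))"
      by simp
    then show ?thesis
      using that(2) by (simp add: vec_eq_iff field_simps)
  qed
  have "c = 0"
    using solve[OF eq] not_combination[of x y z] assms by blast
  moreover have "b = 0"
    using solve[of a x c z b y] eq not_combination[of x z y] assms by (metis add.commute add.assoc)
  moreover have "a = 0"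
    using solve[of b y c z a x] eq not_combination[of y z x] assms by (metis add.commute add.assoc)
  ultimately show "a = 0 \<and> b = 0 \<and> c = 0"
    by blast
qed

text \<open>Four points of an arc form a projective frame of the plane. All four are spanned by
  eigenvectors, and the fourth has nonzero coordinates in the basis of the other three because every
  triple is independent; comparing coordinates makes all eigenvalues equal.\<close>

lemma scalar_if_fixes_4_points:
  assumes f: "linmap f" and F: "F \<subseteq> H" "card F \<ge> 4" and fix_F: "\<And>p. p \<in> F \<Longrightarrow> f ` p = p"
  obtains c where "c \<noteq> 0" "\<And>y. y \<in> W \<Longrightarrow> f y = c *s y"
proof -
  obtain F' where F': "F' \<subseteq> F" "card F' = Suc 3"
    using obtain_subset_with_card_n[OF F(2)] by (metis eval_nat_numeral(3) numeral_eq_Suc pred_numeral_simps(2) semiring_norm(26,27))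
  then obtain p4 G where "F' = insert p4 G" "p4 \<notin> G" "card G = 3"
    unfolding card_Suc_eq by auto
  then obtain p1 p2 p3 where p: "{p1, p2, p3, p4} \<subseteq> F" "distinct [p1, p2, p3, p4]"
    using F'(1) by (auto simp: card_3_iff)
  from p(1) F(1) have pH: "p1 \<in> H" "p2 \<in> H" "p3 \<in> H" "p4 \<in> H"
    by auto
  obtain x1 where x1: "p1 = pt x1" "x1 \<in> W"
    by (rule H_cases[OF pH(1)])
  obtain x2 where x2: "p2 = pt x2" "x2 \<in> W"
    by (rule H_cases[OF pH(2)])
  obtain x3 where x3: "p3 = pt x3" "x3 \<in> W"
    by (rule H_cases[OF pH(3)])
  obtain x4 where x4: "p4 = pt x4" "x4 \<in> W"
    by (rule H_cases[OF pH(4)])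
  note x = x1(1) x2(1) x3(1) x4(1) x1(2) x2(2) x3(2) x4(2)
  have eig: "\<exists>c. c \<noteq> 0 \<and> f x = c *s x" if "pt x \<in> F" for x
    by (rule linmap_pt_fixedE[OF f fix_F[OF that]]) blast
  have xF: "pt x1 \<in> F" "pt x2 \<in> F" "pt x3 \<in> F" "pt x4 \<in> F"
    using p(1) unfolding x by blast+
  obtain c1 where c1: "c1 \<noteq> 0" "f x1 = c1 *s x1"
    using eig[OF xF(1)] by blast
  obtain c2 where c2: "f x2 = c2 *s x2"
    using eig[OF xF(2)] by blast
  obtain c3 where c3: "f x3 = c3 *s x3"
    using eig[OF xF(3)] by blast
  obtain c4 where c4: "f x4 = c4 *s x4"
    using eig[OF xF(4)] by blast
  have xH: "pt x1 \<in> H" "pt x2 \<in> H" "pt x3 \<in> H" "pt x4 \<in> H"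
    using xF F(1) by blast+
  have ne: "pt x1 \<noteq> pt x2" "pt x1 \<noteq> pt x3" "pt x1 \<noteq> pt x4" "pt x2 \<noteq> pt x3" "pt x2 \<noteq> pt x4" "pt x3 \<noteq> pt x4"
    using p(2) unfolding x by simp_all
  have i: "indep3 x1 x2 x3" "indep3 x2 x3 x4" "indep3 x1 x3 x4" "indep3 x1 x2 x4"
    by (rule arc_indep3; fact xH ne)+
  obtain a b c where abc: "x4 = a *s x1 + b *s x2 + c *s x3"
    using indep3_span[OF i(1) x(5-7) dim_W x(8)] .
  have "a \<noteq> 0"
    using indep3D(3)[OF i(2), of b c "-1"] abc by auto
  have "b \<noteq> 0"
    using indep3D(3)[OF i(3), of a c "-1"] abc by auto
  have "c \<noteq> 0"
    using indep3D(3)[OF i(4), of a b "-1"] abc by auto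
  have "(c1 * a) *s x1 + (c2 * b) *s x2 + (c3 * c) *s x3 = f x4"
    by (simp add: abc linmapD[OF f] c1 c2 c3 mult.commute)
  also have "\<dots> = (c4 * a) *s x1 + (c4 * b) *s x2 + (c4 * c) *s x3"
    unfolding c4 by (simp add: abc vector_add_ldistrib)
  finally have "c1 = c4" "c2 = c4" "c3 = c4"
    using indep3_eqD[OF i(1)] \<open>a \<noteq> 0\<close> \<open>b \<noteq> 0\<close> \<open>c \<noteq> 0\<close> by (metis mult_cancel_right)+
  have "f y = c1 *s y" if "y \<in> W" for y
  proof -
    obtain a b c where "y = a *s x1 + b *s x2 + c *s x3"
      using indep3_span[OF i(1) x(5-7) dim_W \<open>y \<in> W\<close>] .
    then show ?thesis
      using c1 c2 c3 \<open>c1 = c4\<close> \<open>c2 = c4\<close> \<open>c3 = c4\<close>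
      by (simp add: linmapD[OF f] vector_add_ldistrib mult.commute)
  qed
  then show thesis
    using that c1(1) by blast
qed

text \<open>The permutation group that linear maps induce on \<open>H\<close>. Its elements are
  functions on the whole type that are the identity off \<open>H\<close>, so that signs and parity
  of permutations are available.\<close>

definition lin_perms :: "(('a ^ 4) set \<Rightarrow> ('a ^ 4) set) set" where
  "lin_perms = {s. s permutes H \<and> (\<exists>f. linmap f \<and> (\<forall>p\<in>H. f ` p = s p))}"

lemma lin_perms_permutes: "s \<in> lin_perms \<Longrightarrow> s permutes H"
  by (simp add: lin_perms_def)

lemma lin_perms_permutation: "s \<in> lin_perms \<Longrightarrow> permutation s"
  using lin_perms_permutes permutation_permutes finite_H by blast

lemma lin_permsE:
  assumes "s \<in> lin_perms"
  obtains f where "linmap f" "\<And>p. p \<in> H \<Longrightarrow> f ` p = s p"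
  using assms by (auto simp: lin_perms_def)

lemma lin_permsI:
  assumes "linmap f" "\<And>p. p \<in> H \<Longrightarrow> f ` p \<in> H" "inj_on ((`) f) H"
  shows "(\<lambda>p. if p \<in> H then f ` p else p) \<in> lin_perms"
proof -
  have "(`) f ` H = H"
    using assms by (intro endo_inj_surj) auto
  then have "bij_betw (\<lambda>p. if p \<in> H then f ` p else p) H H"
    using assms(3) by (auto simp: bij_betw_def inj_on_def image_iff)
  then have "(\<lambda>p. if p \<in> H then f ` p else p) permutes H"
    by (rule bij_imp_permutes) simp
  then show ?thesis
    using assms(1) by (auto simp: lin_perms_def)
qed

lemma id_in_lin_perms: "id \<in> lin_perms"
  unfolding lin_perms_def by (auto simp: permutes_id linmap_iff intro!: exI[of _ "\<lambda>x. x"])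

lemma comp_in_lin_perms:
  assumes "s \<in> lin_perms" "t \<in> lin_perms"
  shows "s \<circ> t \<in> lin_perms"
proof -
  obtain f g where f: "linmap f" "\<And>p. p \<in> H \<Longrightarrow> f ` p = s p"
    and g: "linmap g" "\<And>p. p \<in> H \<Longrightarrow> g ` p = t p"
    using assms lin_permsE by metis
  have "(\<lambda>x. f (g x)) ` p = (s \<circ> t) p" if "p \<in> H" for p
    using f(2)[of "t p"] g(2)[OF that] that lin_perms_permutes[OF assms(2)]
    by (simp add: permutes_in_image flip: image_image)
  then show ?thesis
    using linmap_compose[OF f(1) g(1)] permutes_compose[OF lin_perms_permutes[OF assms(2)] lin_perms_permutes[OF assms(1)]]
    by (auto simp: lin_perms_def)
qed

lemma funpow_in_lin_perms: "s \<in> lin_perms \<Longrightarrow> s ^^ n \<in> lin_perms"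
  by (induction n) (simp_all add: id_in_lin_perms comp_in_lin_perms)

text \<open>A permutation of the finite set \<open>H\<close> has finite order, so its inverse is one
  of its powers.\<close>

lemma inv_in_lin_perms:
  assumes "s \<in> lin_perms"
  shows "perm_inv s \<in> lin_perms"
proof -
  obtain n where n: "s ^^ n = id" "n > 0"
    using permutation_is_nilpotent[OF lin_perms_permutation[OF assms]] .
  then have "s \<circ> s ^^ (n - 1) = id"
    by (metis Suc_pred' funpow.simps(2))
  then have "perm_inv s = s ^^ (n - 1)"
    using lin_perms_permutes[OF assms] by (metis comp_id fun.map_id inv_o_cancel o_assoc permutes_inj id_comp)
  then show ?thesis
    using funpow_in_lin_perms[OF assms] by simp
qed

lemma eq_id_if_fixes_4_points:
  assumes "s \<in> lin_perms" "card {p \<in> H. s p = p} \<ge> 4"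
  shows "s = id"
proof -
  obtain f where f: "linmap f" "\<And>p. p \<in> H \<Longrightarrow> f ` p = s p"
    using assms(1) lin_permsE by metis
  obtain c where c: "c \<noteq> 0" "\<And>y. y \<in> W \<Longrightarrow> f y = c *s y"
    using scalar_if_fixes_4_points[OF f(1) _ assms(2)] f(2) by auto
  have "s p = p" if p: "p \<in> H" for p
  proof -
    obtain x where x: "p = pt x" "x \<in> W"
      by (rule H_cases[OF p])
    then have "f ` p = pt (c *s x)"
      using c(2) linmap_pt[OF f(1)] by simp
    then show ?thesis
      using f(2)[OF p] pt_scale[OF c(1)] x(1) by metis
  qed
  then show ?thesis
    using permutes_not_in[OF lin_perms_permutes[OF assms(1)]] by (metis eq_id_iff)
qed

definition involution :: "(('a ^ 4) set \<Rightarrow> ('a ^ 4) set) \<Rightarrow> bool" where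
  "involution s \<longleftrightarrow> s \<in> lin_perms \<and> s \<circ> s = id \<and> s \<noteq> id"

lemma involution_apply_twice: "involution s \<Longrightarrow> s (s p) = p"
  unfolding involution_def by (metis comp_apply id_apply)

lemma involution_conj:
  assumes "involution s" "t \<in> lin_perms"
  shows "involution (perm_inv t \<circ> s \<circ> t)"
proof -
  have i: "perm_inv t (t p) = p" "t (perm_inv t p) = p" for p
    using lin_perms_permutes[OF assms(2)] by (simp_all add: permutes_inverses)
  have "perm_inv t \<circ> s \<circ> t \<in> lin_perms"
    using assms by (simp add: involution_def comp_in_lin_perms inv_in_lin_perms)
  moreover have "(perm_inv t \<circ> s \<circ> t) \<circ> (perm_inv t \<circ> s \<circ> t) = id"
    using involution_apply_twice[OF assms(1)] i by (simp add: fun_eq_iff)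
  moreover have "perm_inv t \<circ> s \<circ> t \<noteq> id"
  proof
    assume eq: "perm_inv t \<circ> s \<circ> t = id"
    have "s p = p" for p
      using fun_cong[OF eq, of "perm_inv t p"] i(2)[of "s p"] i(2)[of p] by simp
    then show False
      using assms(1) by (auto simp: involution_def)
  qed
  ultimately show ?thesis
    by (simp add: involution_def)
qed

end

section \<open>Monomial hyperovals\<close>

definition lincomb3 :: "('a::field) ^ 'n \<Rightarrow> 'a ^ 'n \<Rightarrow> 'a ^ 'n \<Rightarrow> 'a \<Rightarrow> 'a \<Rightarrow> 'a \<Rightarrow> 'a ^ 'n" where
  "lincomb3 u v w a b c = a *s u + b *s v + c *s w"

lemma lincomb3_unit:
  "lincomb3 u v w 1 0 0 = u" "lincomb3 u v w 0 1 0 = v" "lincomb3 u v w 0 0 1 = w"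
  by (simp_all add: lincomb3_def)

lemma lincomb3_scale: "k *s lincomb3 u v w a b c = lincomb3 u v w (k * a) (k * b) (k * c)"
  by (simp add: lincomb3_def vec_eq_iff algebra_simps)

lemma lincomb3_swap12: "lincomb3 u v w a b c = lincomb3 v u w b a c"
  by (simp add: lincomb3_def add.commute)

lemma lincomb3_swap23: "lincomb3 u v w a b c = lincomb3 u w v a c b"
  by (simp add: lincomb3_def algebra_simps)

lemma lincomb3_nested:
  "lincomb3 (lincomb3 u v w a1 b1 c1) (lincomb3 u v w a2 b2 c2) (lincomb3 u v w a3 b3 c3) a b c =
     lincomb3 u v w (a * a1 + b * a2 + c * a3) (a * b1 + b * b2 + c * b3) (a * c1 + b * c2 + c * c3)"
  by (simp add: lincomb3_def vec_eq_iff algebra_simps)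

lemma linmap_lincomb3: "linmap f \<Longrightarrow> f (lincomb3 u v w a b c) = lincomb3 (f u) (f v) (f w) a b c"
  by (simp add: lincomb3_def linmap_iff)

lemma lincomb3_inject:
  assumes "indep3 u v w" "lincomb3 u v w a b c = lincomb3 u v w a' b' c'"
  shows "a = a' \<and> b = b' \<and> c = c'"
  using indep3_eqD[OF assms(1)] assms(2) unfolding lincomb3_def by blast

lemma pt_lincomb3_eqE:
  assumes "indep3 u v w" "pt (lincomb3 u v w a b c) = pt (lincomb3 u v w a' b' c')"
  obtains k where "k \<noteq> 0" "a = k * a'" "b = k * b'" "c = k * c'"
proof -
  obtain k where "k \<noteq> 0" "lincomb3 u v w a b c = k *s lincomb3 u v w a' b' c'"
    using assms(2) pt_eq_iff by blast
  then show thesis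
    using that[of k] lincomb3_inject[OF assms(1)] unfolding lincomb3_scale by blast
qed

locale hyperoval_in_plane = arc_in_plane W H
  for W :: "('a::{field,finite} ^ 4) set" and H :: "('a ^ 4) set set" +
  fixes h :: nat
  assumes card_H: "card H = CARD('a) + 2" and card_field: "CARD('a) = 2 ^ h"
begin

lemma two_eq_0: "(2::'a) = 0"
  using char_2[OF card_field] .

lemma h_pos: "h > 0"
  using card_field card_field_ge_2[where 'a='a] by (cases h) auto

text \<open>Coordinates in which \<open>H\<close> is the monomial hyperoval with exponent
  \<open>m\<close>. The three special points are \<open>pt u\<close> (parameter 0, as
  \<open>m > 0\<close>), \<open>pt v\<close> and \<open>pt w\<close>; reordering them changes the
  exponent.\<close>

definition frame :: "nat \<Rightarrow> 'a ^ 4 \<Rightarrow> 'a ^ 4 \<Rightarrow> 'a ^ 4 \<Rightarrow> bool" where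
  "frame m u v w \<longleftrightarrow> m > 0 \<and> indep3 u v w \<and>
     H = range (\<lambda>t. pt (lincomb3 u v w 1 t (t ^ m))) \<union> {pt v, pt w}"

context
  fixes m u v w
  assumes frame: "frame m u v w"
begin

private abbreviation P where "P t \<equiv> pt (lincomb3 u v w 1 t (t ^ m))"

lemma m_pos: "m > 0"
  and frame_indep3: "indep3 u v w"
  and frame_eq: "H = range P \<union> {pt v, pt w}"
  using frame by (auto simp: frame_def)

lemma P_0: "P 0 = pt u"
  using m_pos by (simp add: zero_power lincomb3_unit)

lemma P_in: "P t \<in> H"
  and v_in: "pt v \<in> H"
  and w_in: "pt w \<in> H"
  and u_in: "pt u \<in> H"
  using frame_eq P_0 by auto

lemma P_inject: "P t = P s \<longleftrightarrow> t = s"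
  by (auto elim: pt_lincomb3_eqE[OF frame_indep3])

lemma P_neq_v: "P t \<noteq> pt v" "pt v \<noteq> P t"
  using pt_lincomb3_eqE[OF frame_indep3, of 1 t "t ^ m" 0 1 0] by (auto simp: lincomb3_unit)

lemma P_neq_w: "P t \<noteq> pt w" "pt w \<noteq> P t"
  using pt_lincomb3_eqE[OF frame_indep3, of 1 t "t ^ m" 0 0 1] by (auto simp: lincomb3_unit)

lemma v_neq_w: "pt v \<noteq> pt w"
  using pt_lincomb3_eqE[OF frame_indep3, of 0 1 0 0 0 1] by (auto simp: lincomb3_unit)

lemma u_neq: "pt u \<noteq> pt v" "pt u \<noteq> pt w"
  using P_neq_v(1)[of 0] P_neq_w(1)[of 0] P_0 by auto

lemma frame_cases:
  assumes "p \<in> H"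
  obtains "p = pt u" | "p = pt v" | "p = pt w" | t where "t \<noteq> 0" "p = P t"
proof -
  from assms frame_eq consider t where "p = P t" | "p = pt v" | "p = pt w"
    by blast
  then show thesis
    using that P_0 by (metis (no_types, lifting))
qed

text \<open>If the powers agree at different parameters, the two points differ by a multiple of
  \<open>v\<close> and are collinear with \<open>pt v\<close>.\<close>

lemma power_m_inject:
  fixes t s :: 'a
  assumes "t ^ m = s ^ m"
  shows "t = s"
proof (rule ccontr)
  assume "t \<noteq> s"
  then have "indep3 (lincomb3 u v w 1 t (t ^ m)) (lincomb3 u v w 1 s (s ^ m)) v"
    by (intro arc_indep3 P_in v_in P_neq_v) (simp add: P_inject)
  moreover have "1 *s lincomb3 u v w 1 t (t ^ m) + (- 1) *s lincomb3 u v w 1 s (s ^ m) + (s - t) *s v = 0"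
    by (simp add: lincomb3_def assms vec_eq_iff algebra_simps)
  ultimately show False
    using indep3D(1) by fastforce
qed

text \<open>Equal quotients \<open>t ^ m / t\<close> and \<open>s ^ m / s\<close> would put the
  points with parameters \<open>t\<close> and \<open>s\<close> on a line through
  \<open>pt u\<close>, the point with parameter 0.\<close>

lemma power_m_pred_inject:
  fixes t s :: 'a
  assumes "t ^ (m - 1) = s ^ (m - 1)" "t \<noteq> 0" "s \<noteq> 0"
  shows "t = s"
proof (rule ccontr)
  assume "t \<noteq> s"
  then have "indep3 (lincomb3 u v w 1 t (t ^ m)) (lincomb3 u v w 1 s (s ^ m)) (lincomb3 u v w 1 0 (0 ^ m))"
    using assms by (intro arc_indep3 P_in) (simp_all add: P_inject)
  moreover have "t ^ m = t * t ^ (m - 1)" "s ^ m = s * s ^ (m - 1)"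
    using m_pos by (simp_all add: power_eq_if)
  then have "s *s lincomb3 u v w 1 t (t ^ m) + (- t) *s lincomb3 u v w 1 s (s ^ m)
      + (t - s) *s lincomb3 u v w 1 0 (0 ^ m) = 0"
    using m_pos assms(1) by (simp add: lincomb3_def vec_eq_iff algebra_simps zero_power)
  ultimately show False
    using indep3D(1) assms(3) by blast
qed

text \<open>Interchanging the last two coordinates inverts the map \<open>t \<mapsto> t ^ m\<close>.
  This map is a permutation of a finite set, so its inverse is an iterate of it and again a
  monomial.\<close>

lemma frame_swap23: "\<exists>m'. frame m' u w v"
proof -
  have "inj (\<lambda>t::'a. t ^ m)"
    using power_m_inject by (rule injI)
  then have "bij (\<lambda>t::'a. t ^ m)"
    using finite_UNIV_inj_surj[OF finite] by (simp add: bij_def)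
  then have "permutation (\<lambda>t::'a. t ^ m)"
    by (simp add: permutation)
  then obtain n where n: "(\<lambda>t::'a. t ^ m) ^^ n = id" "n > 0"
    using permutation_is_nilpotent by blast
  have "((\<lambda>t::'a. t ^ m) ^^ k) t = t ^ (m ^ k)" for k t
    by (induction k) (simp_all add: mult.commute flip: power_mult)
  then have nm: "t ^ (m ^ n) = t" for t :: 'a
    using n(1) by (metis id_apply)
  define m' where "m' = m ^ (n - 1)"
  have mm: "(t ^ m) ^ m' = t" "(t ^ m') ^ m = t" for t :: 'a
    using nm[of t] \<open>n > 0\<close> by (cases n; simp add: m'_def mult.commute flip: power_mult)+
  have "m' > 0"
    using m_pos by (simp add: m'_def)
  moreover have "range P = range (\<lambda>t. pt (lincomb3 u w v 1 t (t ^ m')))"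
  proof (intro subset_antisym image_subsetI)
    fix t
    show "P t \<in> range (\<lambda>t. pt (lincomb3 u w v 1 t (t ^ m')))"
      by (rule image_eqI[of _ _ "t ^ m"]) (simp_all add: lincomb3_swap23[of u v w] mm)
    show "pt (lincomb3 u w v 1 t (t ^ m')) \<in> range P"
      by (rule image_eqI[of _ _ "t ^ m'"]) (simp_all add: lincomb3_swap23[of u v w] mm)
  qed
  then have "H = range (\<lambda>t. pt (lincomb3 u w v 1 t (t ^ m'))) \<union> {pt w, pt v}"
    using frame_eq by (metis insert_commute)
  ultimately have "frame m' u w v"
    unfolding frame_def using indep3_swap23[OF frame_indep3] by blast
  then show ?thesis ..
qed

text \<open>Interchanging the first two coordinates replaces \<open>m\<close> by \<open>1 - m\<close> modulo \<open>q - 1\<close>, and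
  \<open>q - 2\<close> represents \<open>- 1\<close>.\<close>

lemma frame_swap12: "frame (m * (CARD('a) - 2) + 1) v u w"
proof -
  define m' where "m' = m * (CARD('a) - 2) + 1"
  have m': "s ^ m' = s * inverse s ^ m" if "s \<noteq> 0" for s :: 'a
    using that finite_field_power_card_minus_2[OF that]
    by (simp add: m'_def power_mult mult.commute[of m])
  have P: "P t = pt (lincomb3 v u w 1 (inverse t) (inverse t ^ m'))" if "t \<noteq> 0" for t
  proof -
    have "lincomb3 u v w 1 t (t ^ m) = t *s lincomb3 v u w 1 (inverse t) (inverse t ^ m')"
      using that by (simp add: m' lincomb3_scale lincomb3_swap12[of u v w] flip: mult.assoc)
    then show ?thesis
      using that pt_scale by metis
  qed
  let ?P' = "\<lambda>t. pt (lincomb3 v u w 1 t (t ^ m'))"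
  \<comment> \<open>The nonzero parameters of the two frames correspond under inversion. Parameter 0
    is treated apart: it gives \<open>pt u\<close> in the old frame and \<open>pt v\<close> in the
    new one.\<close>
  have "range P = insert (pt u) (P ` (UNIV - {0}))"
    unfolding P_0[symmetric] by auto
  also have "P ` (UNIV - {0}) = ?P' ` inverse ` (UNIV - {0})"
    using P by (auto simp: image_iff)
  also have "inverse ` (UNIV - {0}) = UNIV - {0::'a}"
    by (intro bij_betw_imp_surj_on[OF bij_betw_byWitness[where f' = inverse]]) auto
  finally have "range P = insert (pt u) (?P' ` (UNIV - {0}))" .
  moreover have "?P' 0 = pt v"
    by (simp add: m'_def lincomb3_unit)
  then have "range ?P' = insert (pt v) (?P' ` (UNIV - {0}))"
    by (metis (no_types, lifting) UNIV_I image_insert insert_Diff)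
  ultimately have "H = range ?P' \<union> {pt u, pt w}"
    using frame_eq by auto
  then show ?thesis
    using frame_indep3 unfolding frame_def m'_def[symmetric] by (auto simp: m'_def intro: indep3_swap12)
qed

text \<open>The collineation diag(1, a, a^m) multiplies the parameter by \<open>a\<close>. These
  maps move any point with nonzero parameter to any other; their evenness serves the parity argument
  of \<open>additive_frame_if_involution\<close>.\<close>

lemma diagonal_perm:
  assumes "a \<noteq> 0"
  obtains s where "s \<in> lin_perms" "\<And>t. s (P t) = P (a * t)" "s (pt v) = pt v" "s (pt w) = pt w" "evenperm s"
proof -
  have *: "\<exists>s. s \<in> lin_perms \<and> (\<forall>t. s (P t) = P (b * t)) \<and> s (pt v) = pt v \<and> s (pt w) = pt w"
    if "b \<noteq> 0" for b
  proof -
    define f0 where "f0 x = (if x = u then u else if x = v then b *s v else b ^ m *s w)" for x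
    have ind: "vec.independent {u, v, w}" "card {u, v, w} = 3"
      using indep3_independent[OF frame_indep3] by auto
    obtain f where f: "linmap f" "\<And>x. x \<in> {u, v, w} \<Longrightarrow> f x = f0 x"
      using vec.linear_independent_extend[OF ind(1), of f0] by blast
    have "u \<noteq> v" "u \<noteq> w" "v \<noteq> w"
      using ind(2) by (auto simp: card_insert_if split: if_splits)
    then have fu: "f u = u" "f v = b *s v" "f w = b ^ m *s w"
      using f(2) by (auto simp: f0_def)
    have "f (lincomb3 u v w 1 t (t ^ m)) = lincomb3 u v w 1 (b * t) ((b * t) ^ m)" for t
      unfolding linmap_lincomb3[OF f(1)] fu by (simp add: lincomb3_def vec_eq_iff algebra_simps)
    then have fP: "f ` P t = P (b * t)" "f ` pt v = pt v" "f ` pt w = pt w" for t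
      using that by (simp_all add: linmap_pt[OF f(1)] fu pt_scale)
    define s where "s p = (if p \<in> H then f ` p else p)" for p
    have "inj_on ((`) f) H"
    proof (rule inj_onI)
      fix p r assume pr: "p \<in> H" "r \<in> H" "f ` p = f ` r"
      have "p = r" if "p \<in> range P" "r \<in> range P"
        using that pr(3) \<open>b \<noteq> 0\<close> by (auto simp: fP P_inject)
      moreover have "p = r" if "p \<in> range P" "r = pt v \<or> r = pt w"
        using that pr(3) P_neq_v P_neq_w by (auto simp: fP)
      moreover have "p = r" if "r \<in> range P" "p = pt v \<or> p = pt w"
        using that pr(3) P_neq_v P_neq_w by (auto simp: fP)
      moreover have "p = r" if "r = pt v \<or> r = pt w" "p = pt v \<or> p = pt w"
        using that pr(3) v_neq_w by (auto simp: fP)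
      ultimately show "p = r"
        using pr(1,2) frame_eq by blast
    qed
    moreover have "f ` p \<in> H" if "p \<in> H" for p
      using that frame_eq fP by auto
    ultimately have "s \<in> lin_perms"
      using lin_permsI[OF f(1)] unfolding s_def by blast
    moreover have "s (P t) = P (b * t)" "s (pt v) = pt v" "s (pt w) = pt w" for t
      by (simp_all add: s_def P_in v_in w_in fP)
    ultimately show ?thesis
      by blast
  qed
  \<comment> \<open>Every element of the field is a square, so the diagonal collineations are squares and hence
    even permutations.\<close>
  define b where "b = a ^ 2 ^ (h - 1)"
  have "CARD('a) = 2 ^ (h - 1) + 2 ^ (h - 1)"
    unfolding card_field using h_pos by (cases h) simp_all
  then have "b * b = a ^ CARD('a)"
    by (simp only: b_def power_add)
  then have b: "b * b = a" "b \<noteq> 0"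
    using assms by (auto simp: finite_field_power_card)
  obtain s where s: "s \<in> lin_perms" "\<And>t. s (P t) = P (b * t)" "s (pt v) = pt v" "s (pt w) = pt w"
    using *[OF b(2)] by blast
  have "evenperm (s \<circ> s)"
    using lin_perms_permutation[OF s(1)] by (simp add: evenperm_comp)
  then show thesis
    using that[of "s \<circ> s"] s comp_in_lin_perms[OF s(1) s(1)] b(1) by (simp flip: mult.assoc)
qed

end

text \<open>For a multiplicative map, additivity with one summand equal to 1 amounts to additivity.
  The vectors \<open>u\<close>, \<open>v\<close>, \<open>w\<close> may be the special points in any
  order, since only some order need give an additive exponent.\<close>

definition additive_frame :: bool where
  "additive_frame \<longleftrightarrow> (\<exists>m u v w. frame m u v w \<and> (\<forall>t::'a. (1 + t) ^ m = 1 + t ^ m))"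

section \<open>Involutions of the hyperoval and additive exponents\<close>

lemma involution_permutes: "involution s \<Longrightarrow> s permutes H"
  by (simp add: involution_def lin_perms_permutes)

lemma involution_in: "involution s \<Longrightarrow> p \<in> H \<Longrightarrow> s p \<in> H"
  by (simp add: involution_permutes permutes_in_image)

lemma involutionE:
  assumes "involution s"
  obtains f where "linmap f" "\<And>x. pt x \<in> H \<Longrightarrow> pt (f x) = s (pt x)"
proof -
  obtain f where f: "linmap f" "\<And>p. p \<in> H \<Longrightarrow> f ` p = s p"
    using assms lin_permsE unfolding involution_def by metis
  show thesis
    by (rule that[OF f(1)]) (simp add: f(2) flip: linmap_pt[OF f(1)])
qed

text \<open>The number of fixed points has the parity of q + 2, which is even, and four fixed points
  would force the identity.\<close>

lemma involution_fixed_points: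
  assumes "involution s"
  shows "card {p \<in> H. s p = p} = 0 \<or> card {p \<in> H. s p = p} = 2"
proof -
  have "\<not> card {p \<in> H. s p = p} \<ge> 4"
    using eq_id_if_fixes_4_points assms by (auto simp: involution_def)
  moreover have "even (card {p \<in> H. s p = p})"
    using even_card_involution_iff[OF finite_H, of s] involution_in[OF assms]
      involution_apply_twice[OF assms] card_H h_pos card_field by simp
  ultimately show ?thesis
    by presburger
qed

text \<open>In characteristic 2 such an involution is an elation with axis \<open>vw\<close>, and it acts on the
  remaining points of the hyperoval like a translation of the parameter \<open>t\<close>.\<close>

lemma additive_if_involution_fixes_v_w:
  fixes t :: 'a
  assumes fr: "frame m u v w" and s: "involution s" and sv: "s (pt v) = pt v" and sw: "s (pt w) = pt w"
  shows "(1 + t) ^ m = 1 + t ^ m"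
proof -
  let ?P = "\<lambda>t. lincomb3 u v w 1 t (t ^ m)"
  note ind = frame_indep3[OF fr]
  obtain f where f: "linmap f" "\<And>x. pt x \<in> H \<Longrightarrow> pt (f x) = s (pt x)"
    using involutionE[OF s] by blast
  have "s (pt u) \<in> H" "s (pt u) \<noteq> pt v" "s (pt u) \<noteq> pt w"
    using involution_in[OF s u_in[OF fr]] involution_apply_twice[OF s, of "pt u"] sv sw u_neq[OF fr] by metis+
  then obtain a where "s (pt u) = pt (?P a)"
    using frame_eq[OF fr] by auto
  then obtain g where "g \<noteq> 0" "f u = g *s ?P a"
    using f(2)[OF u_in[OF fr]] pt_eq_iff by metis
  then have g: "g \<noteq> 0" "f u = lincomb3 u v w g (g * a) (g * a ^ m)"
    by (simp_all add: lincomb3_scale)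
  obtain b where "b \<noteq> 0" "f v = b *s v"
    using f(2)[OF v_in[OF fr]] pt_eq_iff sv by metis
  then have b: "b \<noteq> 0" "f v = lincomb3 u v w 0 b 0"
    by (simp_all add: lincomb3_def)
  obtain c where "c \<noteq> 0" "f w = c *s w"
    using f(2)[OF w_in[OF fr]] pt_eq_iff sw by metis
  then have c: "c \<noteq> 0" "f w = lincomb3 u v w 0 0 c"
    by (simp_all add: lincomb3_def)
  have fl: "f (lincomb3 u v w x y z) =
      lincomb3 u v w (x * g) (x * (g * a) + y * b) (x * (g * a ^ m) + z * c)" for x y z
    unfolding linmap_lincomb3[OF f(1)] g b c lincomb3_nested by simp
  have ff: "f ` (f ` p) = p" if p: "p \<in> H" for p
  proof -
    obtain x where x: "p = pt x"
      by (rule H_cases[OF p])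
    have "f ` p = s p"
      using f p unfolding x by (simp add: linmap_pt)
    moreover obtain y where y: "s p = pt y"
      by (rule H_cases[OF involution_in[OF s p]])
    ultimately have "f ` (f ` p) = s (s p)"
      using f(2)[of y] involution_in[OF s p] by (simp add: linmap_pt[OF f(1)])
    then show ?thesis
      by (simp add: involution_apply_twice[OF s])
  qed
  \<comment> \<open>Since \<open>s\<close> is an involution, \<open>f \<circ> f\<close> fixes every
    point of \<open>H\<close> and is scalar on \<open>W\<close>. Hence \<open>b\<close>,
    \<open>c\<close>, \<open>g\<close> have the same square, and they are equal because squaring is
    injective in characteristic 2.\<close>
  obtain k where k: "k \<noteq> 0" "\<And>y. y \<in> W \<Longrightarrow> f (f y) = k *s y"
    using scalar_if_fixes_4_points[OF linmap_compose[OF f(1) f(1)], of H] ff card_H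
      card_field_ge_2[where 'a='a] by (auto simp flip: image_image)
  have "f (f v) = lincomb3 u v w 0 (k * 1) 0" "f (f w) = lincomb3 u v w 0 0 (k * 1)"
    "f (f u) = lincomb3 u v w (k * 1) 0 0"
    using k(2) ptH_D(1) u_in[OF fr] v_in[OF fr] w_in[OF fr] by (simp_all add: lincomb3_def)
  then have sq: "b * b = k" "c * c = k" "g * g = k"
    unfolding b c g fl by (auto dest: lincomb3_inject[OF ind])
  have eq_if_sq_eq: "x = y" if "x * x = y * y" for x y :: 'a
    using frobenius_inject[OF two_eq_0, of x 1 y] that by (simp add: power2_eq_square)
  have bg: "b = g" "c = g"
    using sq by (auto intro: eq_if_sq_eq)
  have fP: "s (pt (?P t)) = pt (lincomb3 u v w 1 (a + t) (a ^ m + t ^ m))" for t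
  proof -
    have "f (?P t) = g *s lincomb3 u v w 1 (a + t) (a ^ m + t ^ m)"
      unfolding fl bg lincomb3_scale by (simp add: algebra_simps)
    then show ?thesis
      using f(2)[OF P_in[OF fr]] pt_scale[OF g(1)] by metis
  qed
  have add: "(a + t) ^ m = a ^ m + t ^ m" for t
  proof -
    have "s (pt (?P t)) \<in> H" "s (pt (?P t)) \<noteq> pt v" "s (pt (?P t)) \<noteq> pt w"
      using involution_in[OF s P_in[OF fr]] involution_apply_twice[OF s, of "pt (?P t)"] sv sw
        P_neq_v[OF fr] P_neq_w[OF fr] by metis+
    then obtain r where "s (pt (?P t)) = pt (?P r)"
      using frame_eq[OF fr] by auto
    then have eq: "pt (lincomb3 u v w 1 (a + t) (a ^ m + t ^ m)) = pt (?P r)"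
      unfolding fP .
    show ?thesis
      by (rule pt_lincomb3_eqE[OF ind eq]) simp
  qed
  have "a \<noteq> 0"
  proof
    assume "a = 0"
    then have "s (pt (?P t)) = pt (?P t)" for t
      unfolding fP using m_pos[OF fr] by (simp add: zero_power)
    then have "{p \<in> H. s p = p} = H"
      using frame_eq[OF fr] sv sw by auto
    then show False
      using involution_fixed_points[OF s] card_H card_field_ge_2[where 'a='a] by simp
  qed
  \<comment> \<open>Replacing \<open>t\<close> by \<open>a * t\<close> turns additivity with summand
    \<open>a\<close> into additivity with summand 1.\<close>
  have "a ^ m * (1 + t) ^ m = a ^ m * (1 + t ^ m)"
    using add[of "a * t"] by (simp add: algebra_simps flip: power_mult_distrib)
  then show ?thesis
    using \<open>a \<noteq> 0\<close> by simp
qed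

text \<open>The involution sends coordinates (1, t, t^m) to (a, c t^m, b t). Normalizing by the case
  t = 1 shows that \<open>t \<mapsto> t ^ m\<close> is its own inverse, and the arc property then
  forces \<open>t ^ m = 1 / t\<close>.\<close>

lemma additive_frame_if_involution_swaps_v_w:
  assumes fr: "frame m u v w" and s: "involution s" and su: "s (pt u) = pt u" and sv: "s (pt v) = pt w"
  shows additive_frame
proof -
  let ?P = "\<lambda>t. lincomb3 u v w 1 t (t ^ m)"
  note ind = frame_indep3[OF fr]
  have sw: "s (pt w) = pt v"
    using involution_apply_twice[OF s, of "pt v"] sv by simp
  obtain f where f: "linmap f" "\<And>x. pt x \<in> H \<Longrightarrow> pt (f x) = s (pt x)"
    using involutionE[OF s] by blast
  obtain a where "a \<noteq> 0" "f u = a *s u"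
    using f(2)[OF u_in[OF fr]] pt_eq_iff su by metis
  then have a: "a \<noteq> 0" "f u = lincomb3 u v w a 0 0"
    by (simp_all add: lincomb3_def)
  obtain b where "b \<noteq> 0" "f v = b *s w"
    using f(2)[OF v_in[OF fr]] pt_eq_iff sv by metis
  then have b: "b \<noteq> 0" "f v = lincomb3 u v w 0 0 b"
    by (simp_all add: lincomb3_def)
  obtain c where "c \<noteq> 0" "f w = c *s v"
    using f(2)[OF w_in[OF fr]] pt_eq_iff sw by metis
  then have c: "c \<noteq> 0" "f w = lincomb3 u v w 0 c 0"
    by (simp_all add: lincomb3_def)
  have key: "t ^ m * c / a = r \<Longrightarrow> r ^ m = t * b / a" for t r :: 'a
  proof -
    have fP: "f (?P t) = lincomb3 u v w a (t ^ m * c) (t * b)"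
      unfolding linmap_lincomb3[OF f(1)] a b c lincomb3_nested by simp
    have "s (pt (?P t)) \<in> H" "s (pt (?P t)) \<noteq> pt v" "s (pt (?P t)) \<noteq> pt w"
      using involution_in[OF s P_in[OF fr]] involution_apply_twice[OF s, of "pt (?P t)"] sv sw
        P_neq_v[OF fr] P_neq_w[OF fr] by metis+
    then obtain r' where "s (pt (?P t)) = pt (?P r')"
      using frame_eq[OF fr] by auto
    then have "pt (lincomb3 u v w a (t ^ m * c) (t * b)) = pt (?P r')"
      using f(2)[OF P_in[OF fr]] fP by metis
    then obtain k where "a = k * 1" "t ^ m * c = k * r'" "t * b = k * r' ^ m"
      using pt_lincomb3_eqE[OF ind] by metis
    then show "t ^ m * c / a = r \<Longrightarrow> r ^ m = t * b / a"
      using a(1) by auto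
  qed
  have "(t ^ m) ^ m = t" for t :: 'a
  proof -
    have "(c / a) ^ m = b / a"
      using key[OF refl, of 1] by simp
    moreover have "(t ^ m * (c / a)) ^ m = t * (b / a)"
      using key[OF refl, of t] by simp
    ultimately have "(t ^ m) ^ m * (b / a) = t * (b / a)"
      by (metis power_mult_distrib)
    then show ?thesis
      using a(1) b(1) by simp
  qed
  \<comment> \<open>The element \<open>t * t ^ m\<close> is fixed by the power map. For nonzero
    \<open>t\<close> its power with exponent \<open>m - 1\<close> is therefore 1, and injectivity of
    that power makes the element itself 1.\<close>
  then have "(t * t ^ m) ^ m = t * t ^ m" for t :: 'a
    by (simp add: power_mult_distrib mult.commute)
  moreover have "x ^ m = x * x ^ (m - 1)" for x :: 'a
    using m_pos[OF fr] by (metis power_minus_mult mult.commute)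
  ultimately have "(t * t ^ m) ^ (m - 1) = 1 ^ (m - 1)" if "t \<noteq> 0" for t :: 'a
    using that by (metis mult_cancel_left2 no_zero_divisors power_not_zero power_one)
  then have inv: "t * t ^ m = 1" if "t \<noteq> 0" for t :: 'a
    using power_m_pred_inject[OF fr, of "t * t ^ m" 1] that by simp
  \<comment> \<open>This is the exponent after interchanging the first two coordinates. It acts as 1
    - m, that is as 2, since \<open>m\<close> acts as -1 on nonzero elements.\<close>
  define m' where "m' = m * (CARD('a) - 2) + 1"
  have sq: "t ^ m' = t ^ 2" for t :: 'a
  proof (cases "t = 0")
    case False
    have "t ^ m' = t * inverse t ^ m"
      using finite_field_power_card_minus_2[OF False]
      by (simp add: m'_def power_mult mult.commute[of m])
    also have "inverse t ^ m = t"
      using inv[of "inverse t"] False by (simp add: field_simps)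
    finally show ?thesis
      by (simp add: power2_eq_square)
  qed (simp add: m'_def)
  have "(1 + t) ^ m' = 1 + t ^ m'" for t :: 'a
    unfolding sq using frobenius_add[OF two_eq_0, of 1 t 1] by simp
  then show ?thesis
    using frame_swap12[OF fr] unfolding additive_frame_def m'_def by blast
qed

text \<open>In the order \<open>w\<close>, \<open>u\<close>, \<open>v\<close> the fixed points are
  the last two of the frame.\<close>

lemma additive_frame_if_involution_fixes_u_v:
  assumes fr: "frame m u v w" and s: "involution s" "s (pt u) = pt u" "s (pt v) = pt v"
  shows additive_frame
proof -
  obtain m' where "frame m' u w v"
    using frame_swap23[OF fr] ..
  then have "frame (m' * (CARD('a) - 2) + 1) w u v"
    by (rule frame_swap12)
  then show ?thesis
    using additive_if_involution_fixes_v_w[OF _ s(1) s(2) s(3)] unfolding additive_frame_def by blast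
qed

text \<open>There is exactly one further fixed point \<open>Q\<close>. If it is not a frame point,
  either \<open>s\<close> swaps \<open>pt v\<close> and \<open>pt w\<close>, or
  \<open>s (pt v)\<close> has a nonzero parameter and a diagonal collineation can move it to
  \<open>Q\<close>; in the second case a conjugate of \<open>s\<close> fixes \<open>pt u\<close> and
  \<open>pt v\<close>.\<close>

lemma additive_frame_if_involution_fixes_u:
  assumes fr: "frame m u v w" and s: "involution s" "s (pt u) = pt u"
  shows additive_frame
proof -
  let ?P = "\<lambda>t. pt (lincomb3 u v w 1 t (t ^ m))"
  have "pt u \<in> {p \<in> H. s p = p}"
    using s u_in[OF fr] by simp
  moreover have "finite {p \<in> H. s p = p}"
    by simp
  ultimately have "card {p \<in> H. s p = p} \<noteq> 0"
    unfolding card_eq_0_iff by blast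
  then have "card {p \<in> H. s p = p} = 2"
    using involution_fixed_points[OF s(1)] by (elim disjE) contradiction
  then obtain x y where xy: "{p \<in> H. s p = p} = {x, y}" "x \<noteq> y"
    unfolding card_2_iff by blast
  have "\<exists>Q. {p \<in> H. s p = p} = {pt u, Q} \<and> Q \<noteq> pt u"
  proof (cases "x = pt u")
    case True
    then show ?thesis
      using xy by (intro exI[of _ y]) simp
  next
    case False
    then have "y = pt u"
      using \<open>pt u \<in> _\<close> unfolding xy(1) by simp
    then show ?thesis
      using xy by (intro exI[of _ x]) (simp add: insert_commute)
  qed
  then obtain Q where Q: "{p \<in> H. s p = p} = {pt u, Q}" "Q \<noteq> pt u"
    by blast
  then have "Q \<in> H" "s Q = Q"
    by auto
  from frame_cases[OF fr \<open>Q \<in> H\<close>] Q(2)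
  consider "Q = pt v" | "Q = pt w" | b where "b \<noteq> 0" "Q = ?P b"
    by metis
  then show ?thesis
  proof cases
    case 1
    then show ?thesis
      using additive_frame_if_involution_fixes_u_v[OF fr s] \<open>s Q = Q\<close> by simp
  next
    case 2
    obtain m' where "frame m' u w v"
      using frame_swap23[OF fr] ..
    then show ?thesis
      using additive_frame_if_involution_fixes_u_v[OF _ s] \<open>s Q = Q\<close> 2 by blast
  next
    case 3
    have "s (pt v) \<noteq> pt v"
      using Q(1) u_neq[OF fr] v_in[OF fr] 3(2) P_neq_v(1)[OF fr, of b] by auto
    have "s (pt v) \<noteq> pt u"
      using involution_apply_twice[OF s(1), of "pt v"] s(2) u_neq[OF fr] by auto
    from frame_cases[OF fr involution_in[OF s(1) v_in[OF fr]]] \<open>s (pt v) \<noteq> pt v\<close> this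
    consider "s (pt v) = pt w" | a where "a \<noteq> 0" "s (pt v) = ?P a"
      by metis
    then show ?thesis
    proof cases
      case 1
      then show ?thesis
        using additive_frame_if_involution_swaps_v_w[OF fr s] by blast
    next
      case (2 a)
      have "b / a \<noteq> 0"
        using 2 3 by simp
      then obtain c where c: "c \<in> lin_perms" "\<And>t. c (?P t) = ?P (b / a * t)"
        using diagonal_perm[OF fr] by metis
      \<comment> \<open>\<open>r\<close> fixes \<open>pt u\<close> and takes \<open>pt v\<close> to
        \<open>Q\<close>, so conjugation by \<open>r\<close> carries the fixed points
        \<open>pt u\<close> and \<open>Q\<close> of \<open>s\<close> back to \<open>pt u\<close> and
        \<open>pt v\<close>.\<close>
      define r where "r = c \<circ> s"
      have r: "r \<in> lin_perms"
        using c(1) s(1) by (simp add: r_def comp_in_lin_perms involution_def)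
      have "c (?P 0) = ?P 0"
        using c(2)[of 0] by simp
      then have "c (pt u) = pt u"
        unfolding P_0[OF fr] .
      then have "r (pt u) = pt u"
        using s(2) by (simp add: r_def)
      moreover have "r (pt v) = Q"
        using 2 3 c(2)[of a] by (simp add: r_def)
      ultimately have "(perm_inv r \<circ> s \<circ> r) (pt u) = pt u" "(perm_inv r \<circ> s \<circ> r) (pt v) = pt v"
        using s(2) \<open>s Q = Q\<close> lin_perms_permutes[OF r] by (simp_all add: permutes_inv_eq)
      then show ?thesis
        using additive_frame_if_involution_fixes_u_v[OF fr involution_conj[OF s(1) r]] by blast
    qed
  qed
qed

lemma additive_frame_if_involution_fixes_frame_point:
  assumes fr: "frame m u v w" and s: "involution s" "s p = p" "p \<in> {pt u, pt v, pt w}"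
  shows additive_frame
proof -
  obtain m' where m': "frame m' u w v"
    using frame_swap23[OF fr] ..
  show ?thesis
    using s(2,3) additive_frame_if_involution_fixes_u[OF fr s(1)]
      additive_frame_if_involution_fixes_u[OF frame_swap12[OF fr] s(1)]
      additive_frame_if_involution_fixes_u[OF frame_swap12[OF m'] s(1)] by blast
qed

text \<open>The orbit count in \<open>additive_frame_if_involution\<close> needs 2 (q - 1) > q + 2,
  which fails for q = 2 and q = 4. For q = 4, injectivity of the powers \<open>m\<close> and
  \<open>m - 1\<close> on nonzero elements leaves only \<open>m\<close> congruent to 2 modulo
  3.\<close>

lemma additive_frame_small:
  assumes fr: "frame m u v w" and "h \<le> 2"
  shows additive_frame
proof -
  have "(1 + t) ^ m = 1 + t ^ m" for t :: 'a
  proof -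
    consider "h = 1" | "h = 2"
      using h_pos assms(2) by linarith
    then have "(\<forall>t::'a. t ^ m = t) \<or> (\<forall>t::'a. t ^ m = t ^ 2)"
    proof cases
      case 1
      then have "UNIV = {0::'a, 1}"
        using card_field by (intro card_subset_eq[symmetric]) simp_all
      then have "t = 0 \<or> t = 1" for t :: 'a
        by blast
      then have "t ^ m = t" for t :: 'a
        using m_pos[OF fr] by (metis power_one zero_power)
      then show ?thesis
        by blast
    next
      case 2
      then have c: "CARD('a) = 4"
        using card_field by simp
      have cube: "t ^ 3 = 1" if "t \<noteq> 0" for t :: 'a
        using finite_field_power_card_minus_1[OF that] c by simp
      have red: "t ^ (3 * k) = 1" if "t \<noteq> 0" for t :: 'a and k
        using cube[OF that] by (simp add: power_mult)
      have "\<not> UNIV \<subseteq> {0::'a, 1}"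
        using card_mono[of "{0::'a, 1}" UNIV] c by auto
      then obtain z :: 'a where z: "z \<noteq> 0" "z \<noteq> 1"
        by auto
      have "\<not> 3 dvd m"
        using power_m_inject[OF fr, of z 1] z red by (auto elim!: dvdE)
      moreover have "\<not> 3 dvd m - 1"
        using power_m_pred_inject[OF fr, of z 1] z red by (auto elim!: dvdE)
      ultimately have "\<exists>k. m = 3 * k + 2"
        by presburger
      then obtain k where k: "m = 3 * k + 2" ..
      have "t ^ m = t ^ 2" for t :: 'a
        using red[of t k] by (cases "t = 0") (simp_all add: k power_add power2_eq_square)
      then show ?thesis
        by blast
    qed
    then show ?thesis
      using frobenius_add[OF two_eq_0, of 1 t 1] by auto
  qed
  then show ?thesis
    using fr unfolding additive_frame_def by blast
qed

text \<open>If there were no additive frame, no involution would have a fixed point, and every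
  involution would be an odd permutation. The even linear permutations then form a group of odd
  order, whose large orbit has odd size and is preserved by \<open>\<theta>\<close>: this yields a
  fixed point after all.\<close>

lemma additive_frame_if_involution:
  assumes fr: "frame m u v w" and \<theta>: "involution \<theta>"
  shows additive_frame
proof (rule ccontr)
  assume not_add: "\<not> additive_frame"
  let ?P = "\<lambda>t. pt (lincomb3 u v w 1 t (t ^ m))"
  let ?E = "{pt u, pt v, pt w}"
  have "h \<ge> 3"
    using additive_frame_small[OF fr] not_add by linarith
  then obtain k where "h = 3 + k"
    using le_Suc_ex by blast
  then obtain n where n: "CARD('a) = 8 * n" "n > 0"
    using card_field by (simp add: power_add)
  have no_fix_E: "s p \<noteq> p" if "involution s" "p \<in> ?E" for s p
    using additive_frame_if_involution_fixes_frame_point[OF fr that(1) _ that(2)] not_add by blast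
  have E_sub: "?E \<subseteq> H"
    using u_in[OF fr] v_in[OF fr] w_in[OF fr] by blast
  \<comment> \<open>An involution preserving the three frame points would fix one of them, as 3 is
    odd.\<close>
  have "\<exists>p\<in>?E. \<theta> p \<notin> ?E"
  proof (rule ccontr)
    assume "\<not> ?thesis"
    then have "\<theta> p \<in> ?E" if "p \<in> ?E" for p
      using that by blast
    then have "even (card ?E) \<longleftrightarrow> even (card {p \<in> ?E. \<theta> p = p})"
      by (rule even_card_involution_iff[OF _ _ involution_apply_twice[OF \<theta>], rotated]) simp_all
    moreover have "card ?E = 3"
      using u_neq[OF fr] v_neq_w[OF fr] by simp
    moreover have "{p \<in> ?E. \<theta> p = p} = {}"
      using no_fix_E[OF \<theta>] by blast
    ultimately show False
      by (simp only: card.empty) simp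
  qed
  then obtain p0 where p0: "p0 \<in> ?E" "\<theta> p0 \<notin> ?E"
    by blast
  moreover have "\<theta> p0 \<in> H"
    using p0(1) E_sub involution_in[OF \<theta>] by blast
  ultimately obtain a where a: "a \<noteq> 0" "\<theta> p0 = ?P a"
    using frame_cases[OF fr, of "\<theta> p0"] by (metis insertCI)
  \<comment> \<open>Hence \<open>p0\<close> lies in the orbit of the generic points of the hyperoval, so that an involution
    fixing any point is conjugate to one fixing a frame point.\<close>
  have no_fix: "s p \<noteq> p" if s: "involution s" "p \<in> H" for s p
  proof (cases "p \<in> ?E")
    case True
    then show ?thesis
      using no_fix_E s(1) by blast
  next
    case False
    then obtain b where b: "b \<noteq> 0" "p = ?P b"
      using frame_cases[OF fr s(2)] by (metis insertCI)
    have "b / a \<noteq> 0"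
      using a b by simp
    then obtain c where c: "c \<in> lin_perms" "\<And>t. c (?P t) = ?P (b / a * t)"
      using diagonal_perm[OF fr] by metis
    define r where "r = c \<circ> \<theta>"
    have r: "r \<in> lin_perms"
      using c(1) \<theta> by (simp add: r_def comp_in_lin_perms involution_def)
    have "r p0 = p"
      using a b c(2)[of a] by (simp add: r_def)
    then have "s p = p \<Longrightarrow> (perm_inv r \<circ> s \<circ> r) p0 = p0"
      using lin_perms_permutes[OF r] by (simp add: permutes_inv_eq)
    then show ?thesis
      using no_fix_E[OF involution_conj[OF s(1) r] p0(1)] by blast
  qed
  \<comment> \<open>A fixed-point-free involution consists of \<open>(q + 2) / 2\<close> transpositions, an odd number as 4
    divides \<open>q\<close>.\<close>
  have odd_inv: "\<not> evenperm s" if inv_s: "involution s" for s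
  proof -
    have "{p. s p \<noteq> p} = H"
      using no_fix[OF inv_s] permutes_not_in[OF involution_permutes[OF inv_s]] by blast
    then obtain k where k: "card H = 2 * k" "sign s = (- 1) ^ k"
      using involution_sign[OF finite_H involution_permutes[OF inv_s]] inv_s
      unfolding involution_def by auto
    have "k = 4 * n + 1"
      using k(1) n(1) card_H by simp
    then have "sign s = - 1"
      using k(2) by simp
    then show ?thesis
      by (auto simp: sign_def)
  qed
  \<comment> \<open>All involutions are odd, so inversion on the group \<open>N\<close> fixes only
    the identity. Pairing elements with their inverses shows that \<open>N\<close> has odd
    order.\<close>
  define N where "N = {s \<in> lin_perms. evenperm s}"
  have fin: "finite N"
    using finite_permutations[OF finite_H] by (rule finite_subset[rotated]) (auto simp: N_def lin_perms_permutes)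
  have N_comp: "s \<circ> t \<in> N" if "s \<in> N" "t \<in> N" for s t
    using that by (simp add: N_def comp_in_lin_perms lin_perms_permutation evenperm_comp)
  have N_inv: "perm_inv s \<in> N" if "s \<in> N" for s
    using that by (simp add: N_def inv_in_lin_perms lin_perms_permutation evenperm_inv)
  have N_id: "id \<in> N"
    by (simp add: N_def id_in_lin_perms)
  have N_perm: "s permutes H" if "s \<in> N" for s
    using that lin_perms_permutes unfolding N_def by blast
  have N_conj: "\<theta> \<circ> s \<circ> \<theta> \<in> N" if "s \<in> N" for s
    using that \<theta>
    by (simp add: N_def involution_def comp_in_lin_perms lin_perms_permutation evenperm_comp permutation_compose)
  have "s = id" if "s \<in> N" "s \<circ> s = id" for s
    using odd_inv[of s] that by (auto simp: involution_def N_def)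
  then have "{s \<in> N. perm_inv s = s} = {id}"
    using N_id permutes_inv_o(1)[OF N_perm] by force
  moreover have "even (card N) \<longleftrightarrow> even (card {s \<in> N. perm_inv s = s})"
    by (rule even_card_involution_iff[OF fin N_inv permutes_inv_inv[OF N_perm]])
  ultimately have odd_N: "odd (card N)"
    by simp
  define x1 where "x1 = ?P 1"
  define Orb where "Orb = (\<lambda>s. s x1) ` N"
  define S where "S = {s \<in> N. s x1 = x1}"
  \<comment> \<open>Orbit counting: the elements of \<open>N\<close> taking \<open>x1\<close> to
    \<open>y\<close> form a coset of the stabilizer \<open>S\<close>, so the orbit size divides the
    odd order of \<open>N\<close>.\<close>
  have fibre: "card {s \<in> N. s x1 = y} = card S" if "y \<in> Orb" for y
  proof -
    obtain t where t: "t \<in> N" "t x1 = y"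
      using \<open>y \<in> Orb\<close> by (auto simp: Orb_def)
    have ti: "perm_inv t \<circ> t = id" "t \<circ> perm_inv t = id"
      using permutes_inv_o[OF N_perm[OF t(1)]] by blast+
    have "bij_betw (\<lambda>s. t \<circ> s) S {s \<in> N. s x1 = y}"
    proof (rule bij_betw_byWitness[where f' = "\<lambda>s. perm_inv t \<circ> s"])
      show "(\<lambda>s. perm_inv t \<circ> s) ` {s \<in> N. s x1 = y} \<subseteq> S"
        using t N_comp N_inv ti by (auto simp: S_def fun_eq_iff)
    qed (use t N_comp ti in \<open>auto simp: S_def o_assoc\<close>)
    from bij_betw_same_card[OF this] show ?thesis
      by (rule sym)
  qed
  have "card N = (\<Sum>y\<in>Orb. card {s \<in> N. s x1 = y})"
    using sum.image_gen[OF fin, of "\<lambda>_. 1::nat" "\<lambda>s. s x1"] by (simp add: Orb_def)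
  also have "\<dots> = (\<Sum>y\<in>Orb. card S)"
    by (rule sum.cong[OF refl fibre])
  finally have odd_Orb: "odd (card Orb)"
    using odd_N by simp
  have "x1 \<in> H"
    unfolding x1_def by (rule P_in[OF fr])
  then have Orb_sub: "Orb \<subseteq> H"
    using permutes_in_image[OF N_perm] unfolding Orb_def by blast
  have sub: "?P ` (UNIV - {0}) \<subseteq> Orb"
  proof
    fix p assume "p \<in> ?P ` (UNIV - {0})"
    then obtain b where b: "b \<noteq> 0" "p = ?P b"
      by blast
    obtain c where c: "c \<in> lin_perms" "\<And>t. c (?P t) = ?P (b * t)" "evenperm c"
      using diagonal_perm[OF fr b(1)] by metis
    then have "c \<in> N" "c x1 = p"
      using b(2) c(2)[of 1] unfolding N_def x1_def by simp_all
    then show "p \<in> Orb"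
      unfolding Orb_def by blast
  qed
  have "card (?P ` (UNIV - {0})) = CARD('a) - 1"
    using P_inject[OF fr] by (simp add: card_image inj_on_def card_Diff_singleton)
  with card_mono[OF finite sub] have card_Orb: "card Orb \<ge> CARD('a) - 1"
    by simp
  have \<theta>Orb_card: "card (\<theta> ` Orb) = card Orb"
    using involution_permutes[OF \<theta>] by (intro card_image) (metis inj_on_subset permutes_inj subset_UNIV)
  \<comment> \<open>\<open>\<theta>\<close> normalizes \<open>N\<close>, so it maps \<open>Orb\<close> to an orbit of the same size, and there is no room for
    two such orbits. An involution acting on a set of odd size has a fixed point.\<close>
  have "Orb \<inter> \<theta> ` Orb \<noteq> {}"
  proof
    assume "Orb \<inter> \<theta> ` Orb = {}"
    then have "card (Orb \<union> \<theta> ` Orb) = card Orb + card Orb"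
      using \<theta>Orb_card by (simp add: card_Un_disjoint)
    moreover have "Orb \<union> \<theta> ` Orb \<subseteq> H"
      using Orb_sub involution_in[OF \<theta>] by blast
    ultimately have "card Orb + card Orb \<le> CARD('a) + 2"
      using card_mono[OF finite_H] card_H by metis
    then show False
      using card_Orb n by linarith
  qed
  then obtain s1 s2 where s: "s1 \<in> N" "s2 \<in> N" "s1 x1 = \<theta> (s2 x1)"
    by (auto simp: Orb_def)
  have "\<theta> p \<in> Orb" if "p \<in> Orb" for p
  proof -
    obtain t where t: "t \<in> N" "p = t x1"
      using \<open>p \<in> Orb\<close> by (auto simp: Orb_def)
    \<comment> \<open>On \<open>x1\<close>, the factor \<open>s1\<close> followed by
      \<open>\<theta>\<close> gives \<open>s2 x1\<close>; \<open>t \<circ> perm_inv s2\<close> takes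
      this to \<open>p\<close>, and the outer \<open>\<theta>\<close> gives
      \<open>\<theta> p\<close>. Normality keeps the composite in \<open>N\<close>.\<close>
    define r where "r = (\<theta> \<circ> (t \<circ> perm_inv s2) \<circ> \<theta>) \<circ> s1"
    have "r \<in> N"
      unfolding r_def using s t by (intro N_comp N_conj N_inv)
    moreover have "r x1 = \<theta> p"
      using s(3) t(2) involution_apply_twice[OF \<theta>] permutes_inverses(2)[OF N_perm[OF s(2)]] by (simp add: r_def)
    ultimately show ?thesis
      unfolding Orb_def by (metis imageI)
  qed
  then have "even (card Orb) \<longleftrightarrow> even (card {p \<in> Orb. \<theta> p = p})"
    by (rule even_card_involution_iff[OF finite _ involution_apply_twice[OF \<theta>]])
  moreover have "{p \<in> Orb. \<theta> p = p} = {}"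
    using no_fix[OF \<theta>] Orb_sub by blast
  ultimately show False
    using odd_Orb by simp
qed

section \<open>Frames and projective equivalence\<close>

lemma image_monomial_set:
  fixes f :: "'a ^ 3 \<Rightarrow> 'a ^ 4"
  assumes "linmap f"
  shows "(\<lambda>U. f ` U) ` monomial_set m = range (\<lambda>t. pt (f (vector [1, t, t ^ m])))
    \<union> {pt (f (vector [0, 1, 0])), pt (f (vector [0, 0, 1]))}"
proof -
  have "(monomial_set m :: ('a ^ 3) set set) =
    range (\<lambda>t. pt (vector [1, t, t ^ m])) \<union> {pt (vector [0, 1, 0]), pt (vector [0, 0, 1])}"
    by (auto simp: monomial_set_def pt_def)
  then show ?thesis
    by (simp only: image_Un image_image image_insert image_empty linmap_pt[OF assms])
qed

text \<open>The frame vectors are the images of the standard basis under the embedding; conversely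
  they are a basis of \<open>W\<close> and determine the embedding.\<close>

lemma proj_equivalent_iff_frame:
  assumes "m > 0"
  shows "proj_equivalent W H (monomial_set m) \<longleftrightarrow> (\<exists>u v w. frame m u v w)"
proof
  assume "proj_equivalent W H (monomial_set m)"
  then obtain f :: "'a ^ 3 \<Rightarrow> 'a ^ 4" where f: "linmap f" "inj f" "range f = W" "H = (\<lambda>U. f ` U) ` monomial_set m"
    unfolding proj_equivalent_def by blast
  define u v w where "u = f (vector [1, 0, 0])" and "v = f (vector [0, 1, 0])" and "w = f (vector [0, 0, 1])"
  have vec3: "vector [a, b, c] = a *s vector [1, 0, 0] + b *s vector [0, 1, 0] + c *s (vector [0, 0, 1] :: 'a ^ 3)" for a b c
    by (simp add: vec_eq_iff forall_3)
  have fl: "f (vector [a, b, c]) = lincomb3 u v w a b c" for a b c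
    unfolding vec3[of a b c] by (simp add: linmapD[OF f(1)] u_def v_def w_def lincomb3_def)
  have "indep3 u v w"
    unfolding indep3_def
  proof (intro allI impI)
    fix a b c assume "a *s u + b *s v + c *s w = 0"
    then have "f (vector [a, b, c]) = f (vector [0, 0, 0])"
      unfolding fl by (simp add: lincomb3_def)
    then have "vector [a, b, c] = (vector [0, 0, 0] :: 'a ^ 3)"
      using f(2) by (simp add: inj_eq)
    then show "a = 0 \<and> b = 0 \<and> c = 0"
      by (simp add: vec_eq_iff forall_3)
  qed
  moreover have "H = range (\<lambda>t. pt (lincomb3 u v w 1 t (t ^ m))) \<union> {pt v, pt w}"
    unfolding f(4) image_monomial_set[OF f(1)] fl lincomb3_unit ..
  ultimately show "\<exists>u v w. frame m u v w"
    unfolding frame_def using assms by blast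
next
  assume "\<exists>u v w. frame m u v w"
  then obtain u v w where fr: "frame m u v w"
    by blast
  note ind = frame_indep3[OF fr]
  have in_W: "u \<in> W" "v \<in> W" "w \<in> W"
    using ptH_D(1) u_in[OF fr] v_in[OF fr] w_in[OF fr] by blast+
  define f :: "'a ^ 3 \<Rightarrow> 'a ^ 4" where "f x = lincomb3 u v w (x $ 1) (x $ 2) (x $ 3)" for x
  have f: "linmap f"
    by (simp add: linmap_iff f_def lincomb3_def vec_eq_iff algebra_simps)
  have "inj f"
  proof (rule injI)
    fix x y assume "f x = f y"
    then have "x $ 1 = y $ 1 \<and> x $ 2 = y $ 2 \<and> x $ 3 = y $ 3"
      unfolding f_def by (rule lincomb3_inject[OF ind])
    then show "x = y"
      by (simp add: vec_eq_iff forall_3)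
  qed
  moreover have "range f = W"
  proof (intro subset_antisym subsetI)
    fix y assume "y \<in> W"
    then obtain a b c where "y = a *s u + b *s v + c *s w"
      using indep3_span[OF ind in_W dim_W] by blast
    then have "y = f (vector [a, b, c])"
      by (simp add: f_def lincomb3_def)
    then show "y \<in> range f"
      by blast
  next
    fix y assume "y \<in> range f"
    then show "y \<in> W"
      using in_W by (auto simp: f_def lincomb3_def intro!: vec.subspace_add[OF subspace_W] vec.subspace_scale[OF subspace_W])
  qed
  moreover have "H = (\<lambda>U. f ` U) ` monomial_set m"
    unfolding frame_eq[OF fr] image_monomial_set[OF f] by (simp add: f_def lincomb3_unit)
  ultimately show "proj_equivalent W H (monomial_set m)"
    unfolding proj_equivalent_def using f by blast
qed

text \<open>For exponent 0 the points (1, 0, 1), (1, 1, 1) and (0, 1, 0) would be collinear; the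
  first arises because \<open>0 ^ 0 = 1\<close>.\<close>

lemma exponent_pos:
  assumes "proj_equivalent W H (monomial_set m)"
  shows "m > 0"
proof (rule ccontr)
  assume "\<not> m > 0"
  with assms obtain f :: "'a ^ 3 \<Rightarrow> 'a ^ 4" where f: "linmap f" "inj f" "H = (\<lambda>U. f ` U) ` monomial_set 0"
    unfolding proj_equivalent_def by auto
  let ?x = "\<lambda>t. vector [1, t, 1] :: 'a ^ 3" and ?y = "vector [0, 1, 0] :: 'a ^ 3"
  have inH: "pt (f (?x 0)) \<in> H" "pt (f (?x 1)) \<in> H" "pt (f ?y) \<in> H"
    unfolding f(3) image_monomial_set[OF f(1)] by (auto intro: range_eqI[of _ _ 0] range_eqI[of _ _ 1])
  have *: "pt (f x) = pt (f y) \<Longrightarrow> \<exists>c. x = c *s y" for x y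
    using f(2) unfolding pt_eq_iff by (metis linmapD(2)[OF f(1)] injD)
  have "pt (f (?x 0)) \<noteq> pt (f (?x 1))" "pt (f (?x 0)) \<noteq> pt (f ?y)" "pt (f (?x 1)) \<noteq> pt (f ?y)"
    using *[of "?x 0" "?x 1"] *[of "?x 0" ?y] *[of "?x 1" ?y] by (auto simp: vec_eq_iff forall_3)
  then have "f ?y \<noteq> (- 1) *s f (?x 0) + 1 *s f (?x 1)"
    by (intro not_combination inH)
  moreover have "?y = (- 1) *s ?x 0 + 1 *s ?x 1"
    by (simp add: vec_eq_iff forall_3)
  then have "f ?y = (- 1) *s f (?x 0) + 1 *s f (?x 1)"
    using linmapD[OF f(1)] by metis
  ultimately show False ..
qed

text \<open>The exponent acts as a power \<open>2 ^ k\<close> of 2. Coprimality of \<open>k\<close>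
  and \<open>h\<close> is again the arc property: \<open>power_m_pred_inject\<close> makes the power
  \<open>2 ^ k - 1\<close> injective on nonzero elements.\<close>

lemma translation_if_additive_frame:
  assumes additive_frame
  obtains k where "coprime k h" "proj_equivalent W H (monomial_set (2 ^ k))"
proof -
  obtain m u v w where fr: "frame m u v w" and add: "\<And>t::'a. (1 + t) ^ m = 1 + t ^ m"
    using assms unfolding additive_frame_def by blast
  obtain k where k: "\<And>t::'a. t ^ m = t ^ 2 ^ k"
    using additive_power_eq_frobenius[OF two_eq_0 m_pos[OF fr] add] by blast
  have "frame (2 ^ k) u v w"
    using fr unfolding frame_def k by simp
  then have "proj_equivalent W H (monomial_set (2 ^ k))"
    using proj_equivalent_iff_frame[of "2 ^ k"] by auto
  moreover have "coprime k h"
    using card_field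
  proof (rule coprime_of_inj_power)
    fix t :: 'a assume "t \<noteq> 0" "t ^ (2 ^ k - 1) = 1"
    then show "t = 1"
      using power_m_pred_inject[OF \<open>frame (2 ^ k) u v w\<close>, of t 1] by simp
  qed
  ultimately show thesis
    using that by blast
qed

end

section \<open>The translation group\<close>

text \<open>A linear form with kernel \<open>W\<close> and a vector at which it takes the value 1.
  Every affine point is then \<open>pt (e + w)\<close> for a unique
  \<open>w \<in> W\<close>.\<close>

locale affine_chart =
  fixes W :: "('a::{field,finite} ^ 4) set" and \<phi> :: "'a ^ 4 \<Rightarrow> 'a" and e :: "'a ^ 4"
  assumes \<phi>_add: "\<phi> (x + y) = \<phi> x + \<phi> y" and \<phi>_scale: "\<phi> (c *s x) = c * \<phi> x"
    and W_eq: "W = {x. \<phi> x = 0}" and \<phi>_e: "\<phi> e = 1"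

text \<open>As \<open>W\<close> has codimension 1, any \<open>e\<close> outside \<open>W\<close>
  complements it, and \<open>\<phi>\<close> reads off the coefficient of \<open>e\<close>.\<close>

lemma affine_chart_exists:
  fixes W :: "('a::{field,finite} ^ 4) set"
  assumes "W \<in> proj_planes"
  shows "\<exists>\<phi> e. affine_chart W \<phi> e"
proof -
  have W: "vec.subspace W" "vec.dim W = 3"
    using assms by (auto simp: proj_planes_def)
  have "vec.dim (UNIV :: ('a ^ 4) set) = 4"
    by (simp add: card_cart_basis)
  then have "W \<noteq> UNIV"
    using W(2) by auto
  then obtain e where e: "e \<notin> W"
    by blast
  have span_W: "vec.span W = W"
    using W(1) by (simp add: vec.span_eq_iff)
  have "vec.dim (insert e W) = 4"
    using e W(2) by (simp add: vec.dim_insert span_W)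
  then have "vec.span (insert e W) = UNIV"
    using vec.dim_eq_span[of "insert e W" UNIV] by (simp add: card_cart_basis)
  then have "\<exists>c. x - c *s e \<in> W" for x
    using vec.span_breakdown_eq[of x e W] by (simp add: span_W)
  then obtain \<phi> where \<phi>: "\<And>x. x - \<phi> x *s e \<in> W"
    by metis
  have uniq: "c = \<phi> x" if "x - c *s e \<in> W" for c x
  proof (rule ccontr)
    assume "c \<noteq> \<phi> x"
    have "(x - c *s e) - (x - \<phi> x *s e) = (\<phi> x - c) *s e"
      by (simp add: vec_eq_iff algebra_simps)
    then have "(\<phi> x - c) *s e \<in> W"
      using vec.subspace_diff[OF W(1) that \<phi>[of x]] by simp
    then have "(1 / (\<phi> x - c)) *s ((\<phi> x - c) *s e) \<in> W"
      by (rule vec.subspace_scale[OF W(1)])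
    moreover have "(1 / (\<phi> x - c)) * (\<phi> x - c) = 1"
      using \<open>c \<noteq> \<phi> x\<close> by simp
    ultimately have "e \<in> W"
      by (simp only: vector_smult_assoc vector_smult_lid)
    then show False
      using e by contradiction
  qed
  have "affine_chart W \<phi> e"
  proof
    fix x y c
    have "(x + y) - (\<phi> x + \<phi> y) *s e = (x - \<phi> x *s e) + (y - \<phi> y *s e)"
      by (simp add: vec_eq_iff algebra_simps)
    then show "\<phi> (x + y) = \<phi> x + \<phi> y"
      using uniq vec.subspace_add[OF W(1) \<phi> \<phi>] by metis
    have "c *s x - (c * \<phi> x) *s e = c *s (x - \<phi> x *s e)"
      by (simp add: vec_eq_iff algebra_simps)
    then show "\<phi> (c *s x) = c * \<phi> x"
      using uniq vec.subspace_scale[OF W(1) \<phi>] by metis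
    show "W = {x. \<phi> x = 0}"
    proof (intro subset_antisym subsetI)
      fix z assume "z \<in> W"
      then show "z \<in> {x. \<phi> x = 0}"
        using uniq[of z 0] by simp
    next
      fix z assume "z \<in> {x. \<phi> x = 0}"
      then show "z \<in> W"
        using \<phi>[of z] by simp
    qed
    show "\<phi> e = 1"
      using uniq[of e 1] vec.subspace_0[OF W(1)] by simp
  qed
  then show ?thesis
    by blast
qed

context affine_chart
begin

lemma \<phi>_0: "\<phi> 0 = 0"
  using \<phi>_scale[of 0 0] by simp

lemma subspace_plane: "vec.subspace W"
  by (simp add: vec.subspace_def W_eq \<phi>_add \<phi>_scale \<phi>_0)

lemma \<phi>_diff: "\<phi> (x - y) = \<phi> x - \<phi> y"
  using \<phi>_add[of "x - y" y] by simp

lemma \<phi>_W: "w \<in> W \<Longrightarrow> \<phi> w = 0"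
  by (simp add: W_eq)

lemma W_closed: "0 \<in> W" "w \<in> W \<Longrightarrow> w' \<in> W \<Longrightarrow> w + w' \<in> W" "w \<in> W \<Longrightarrow> w' \<in> W \<Longrightarrow> w' - w \<in> W"
    "w \<in> W \<Longrightarrow> - w \<in> W" "w \<in> W \<Longrightarrow> c *s w \<in> W"
  using subspace_plane by (simp_all add: vec.subspace_0 vec.subspace_add vec.subspace_diff vec.subspace_neg vec.subspace_scale)

lemma mem_affine_points_iff: "p \<in> affine_points W \<longleftrightarrow> (\<exists>w\<in>W. p = pt (e + w))"
proof
  assume "p \<in> affine_points W"
  then have "p \<in> proj_points" "\<not> p \<subseteq> W"
    by (simp_all add: affine_points_def)
  then obtain x where x: "p = pt x" "x \<notin> W"
    unfolding proj_points_iff using pt_subset_iff[OF subspace_plane] by blast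
  define w where "w = (1 / \<phi> x) *s x - e"
  have nz: "\<phi> x \<noteq> 0"
    using x(2) by (simp add: W_eq)
  have "w \<in> W"
    unfolding W_eq using nz by (simp add: w_def \<phi>_diff \<phi>_scale \<phi>_e)
  moreover have "pt (e + w) = p"
    using nz x(1) pt_scale[of "1 / \<phi> x" x] by (simp add: w_def)
  ultimately show "\<exists>w\<in>W. p = pt (e + w)"
    by blast
next
  assume "\<exists>w\<in>W. p = pt (e + w)"
  then obtain w where w: "w \<in> W" "p = pt (e + w)"
    by blast
  have "\<phi> (e + w) = 1"
    using w(1) by (simp add: \<phi>_add \<phi>_e \<phi>_W)
  then have "e + w \<notin> W" "e + w \<noteq> 0"
    using \<phi>_0 by (auto simp: W_eq)
  then show "p \<in> affine_points W"
    by (auto simp: affine_points_def w(2) pt_in_proj_points_iff pt_subset_iff[OF subspace_plane])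
qed

lemma pt_affine_inject:
  assumes "w \<in> W" "w' \<in> W" "pt (e + w) = pt (e + w')"
  shows "w = w'"
proof -
  obtain c where c: "e + w = c *s (e + w')"
    using assms(3) pt_eq_iff by blast
  have "\<phi> (e + w) = \<phi> (c *s (e + w'))"
    by (simp only: c)
  then have "c = 1"
    using assms(1,2) by (simp add: \<phi>_add \<phi>_scale \<phi>_e \<phi>_W)
  then show ?thesis
    using c by simp
qed

lemma bij_betw_affine_points: "bij_betw (\<lambda>w. pt (e + w)) W (affine_points W)"
  unfolding bij_betw_def using pt_affine_inject mem_affine_points_iff by (auto simp: inj_on_def)

text \<open>For \<open>w \<in> W\<close> this is the elation with axis \<open>W\<close> that induces
  the translation by \<open>w\<close> on the affine points.\<close>

definition shear :: "'a ^ 4 \<Rightarrow> 'a ^ 4 \<Rightarrow> 'a ^ 4" where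
  "shear w x = x + \<phi> x *s w"

lemma linmap_shear: "linmap (shear w)"
  by (simp add: linmap_iff shear_def \<phi>_add \<phi>_scale vec_eq_iff algebra_simps)

lemma \<phi>_shear: "w \<in> W \<Longrightarrow> \<phi> (shear w x) = \<phi> x"
  by (simp add: shear_def \<phi>_add \<phi>_scale \<phi>_W)

lemma shear_shear: "w' \<in> W \<Longrightarrow> shear w (shear w' x) = shear (w + w') x"
  by (simp add: shear_def \<phi>_add \<phi>_scale \<phi>_W vec_eq_iff algebra_simps)

lemma shear_0: "shear 0 x = x"
  by (simp add: shear_def)

lemma shear_W: "x \<in> W \<Longrightarrow> shear w x = x"
  by (simp add: shear_def \<phi>_W)

lemma shear_image_image: "w' \<in> W \<Longrightarrow> shear w ` shear w' ` U = shear (w + w') ` U"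
  by (simp add: image_image shear_shear)

lemma shear_affine: "w' \<in> W \<Longrightarrow> shear w ` pt (e + w') = pt (e + (w' + w))"
  by (simp add: linmap_pt[OF linmap_shear]) (simp add: shear_def \<phi>_add \<phi>_e \<phi>_W add.assoc)

lemma bij_shear:
  assumes "w \<in> W"
  shows "bij (shear w)"
  by (rule bij_betw_byWitness[where f' = "shear (- w)"])
    (use assms in \<open>auto simp: shear_shear shear_0 W_closed\<close>)

lemma shear_affine_points: "w \<in> W \<Longrightarrow> p \<in> affine_points W \<Longrightarrow> shear w ` p \<in> affine_points W"
  unfolding mem_affine_points_iff using shear_affine W_closed(2) by blast

lemma shear_proj_points: "w \<in> W \<Longrightarrow> p \<in> proj_points \<Longrightarrow> shear w ` p \<in> proj_points"
  using \<phi>_shear shear_W W_closed(1) \<phi>_0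
  by (auto simp: proj_points_iff linmap_pt[OF linmap_shear])
    (metis (no_types) bij_is_inj bij_shear injD)

text \<open>The set \<open>S\<close> is a parameter because the action is needed twice: on the
  affine points for the Singer group, and on all points for the subgroup of \<open>PGL\<close>
  inducing it.\<close>

definition act :: "('a ^ 4) set set \<Rightarrow> 'a ^ 4 \<Rightarrow> ('a ^ 4) set \<Rightarrow> ('a ^ 4) set" where
  "act S w = (\<lambda>p\<in>S. shear w ` p)"

text \<open>A linear map that is the identity on \<open>W\<close> is determined by its value at
  \<open>e\<close>, and \<open>f e - e\<close> is the translation vector.\<close>

lemma translation_group_eq: "translation_group W = act (affine_points W) ` W"
proof (intro subset_antisym subsetI)
  fix g assume "g \<in> translation_group W"
  then obtain f where f: "g = (\<lambda>p\<in>affine_points W. f ` p)" "linmap f" "\<And>w. w \<in> W \<Longrightarrow> f w = w"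
      "\<And>x. f x - x \<in> W"
    unfolding translation_group_def by blast
  define w where "w = f e - e"
  have "f x = shear w x" for x
  proof -
    have "x - \<phi> x *s e \<in> W"
      by (simp add: W_eq \<phi>_diff \<phi>_scale \<phi>_e)
    then have "f (\<phi> x *s e + (x - \<phi> x *s e)) = \<phi> x *s f e + (x - \<phi> x *s e)"
      by (simp only: linmapD[OF f(2)] f(3))
    then show ?thesis
      by (simp add: shear_def w_def vec_eq_iff algebra_simps)
  qed
  then have "g = act (affine_points W) w"
    by (simp add: f(1) act_def)
  then show "g \<in> act (affine_points W) ` W"
    using f(4)[of e] by (simp add: w_def)
next
  fix g assume "g \<in> act (affine_points W) ` W"
  then obtain w where w: "w \<in> W" "g = act (affine_points W) w"
    by blast
  have "shear w x - x \<in> W" for x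
    using w(1) by (simp add: shear_def W_closed)
  then show "g \<in> translation_group W"
    unfolding translation_group_def using w(2) linmap_shear shear_W by (auto simp: act_def)
qed

context
  fixes S :: "('a ^ 4) set set"
  assumes S: "\<And>w p. w \<in> W \<Longrightarrow> p \<in> S \<Longrightarrow> shear w ` p \<in> S"
begin

lemma act_act: "w' \<in> W \<Longrightarrow> p \<in> S \<Longrightarrow> act S w (act S w' p) = act S (w + w') p"
  by (simp add: act_def S shear_image_image)

lemma act_0: "act S 0 = (\<lambda>p\<in>S. p)"
  by (auto simp: act_def shear_0 restrict_def)

lemma act_in: "w \<in> W \<Longrightarrow> p \<in> S \<Longrightarrow> act S w p \<in> S"
  by (simp add: act_def S)

lemma act_Bij:
  assumes "w \<in> W"
  shows "act S w \<in> Bij S"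
proof -
  have "bij_betw (act S w) S S"
    by (rule bij_betw_byWitness[where f' = "act S (- w)"])
      (use assms in \<open>auto simp: act_act act_0 act_in W_closed\<close>)
  then show ?thesis
    by (simp add: Bij_def act_def)
qed

lemma act_mult:
  assumes "w \<in> W" "w' \<in> W"
  shows "act S w \<otimes>\<^bsub>BijGroup S\<^esub> act S w' = act S (w + w')"
proof -
  have "compose S (act S w) (act S w') p = act S (w + w') p" for p
    using act_act[OF assms(2), of p w] by (cases "p \<in> S") (simp_all add: compose_def, simp add: act_def)
  then have "compose S (act S w) (act S w') = act S (w + w')" ..
  then show ?thesis
    using act_Bij assms by (simp add: BijGroup_def)
qed

lemma act_one: "act S 0 = \<one>\<^bsub>BijGroup S\<^esub>"
  by (simp add: BijGroup_def act_0)

lemma act_carrier: "w \<in> W \<Longrightarrow> act S w \<in> carrier (BijGroup S)"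
  by (simp add: BijGroup_def act_Bij)

lemma act_inv:
  assumes "w \<in> W"
  shows "inv\<^bsub>BijGroup S\<^esub> (act S w) = act S (- w)"
  using assms by (intro group.inv_equality[OF group_BijGroup]) (simp_all add: act_mult W_closed act_one act_carrier)

lemma subgroup_act: "subgroup (act S ` W) (BijGroup S)"
proof (rule group.subgroupI[OF group_BijGroup])
  show "act S ` W \<noteq> {}"
    using W_closed(1) by blast
qed (use W_closed in \<open>auto simp: act_carrier act_inv act_mult\<close>)

end

section \<open>The translations form a linear Singer group\<close>

lemma sharply_transitive_translations: "sharply_transitive (translation_group W) (affine_points W)"
  unfolding sharply_transitive_def translation_group_eq
proof (intro ballI)
  fix x y assume "x \<in> affine_points W" "y \<in> affine_points W"
  then obtain a b where ab: "x = pt (e + a)" "y = pt (e + b)" "a \<in> W" "b \<in> W"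
    unfolding mem_affine_points_iff by blast
  have act: "act (affine_points W) w x = pt (e + (a + w))" for w
    using \<open>x \<in> affine_points W\<close> ab by (simp add: act_def shear_affine)
  show "\<exists>!g. g \<in> act (affine_points W) ` W \<and> g x = y"
  proof
    show "act (affine_points W) (b - a) \<in> act (affine_points W) ` W \<and> act (affine_points W) (b - a) x = y"
      using act[of "b - a"] ab(2-4) by (simp add: W_closed)
  next
    fix g assume "g \<in> act (affine_points W) ` W \<and> g x = y"
    then obtain w where w: "w \<in> W" "g = act (affine_points W) w" "pt (e + (a + w)) = pt (e + b)"
      using act ab(2) by auto
    have "a + w = b"
      using pt_affine_inject[OF _ _ w(3)] w(1) ab by (simp add: W_closed)
    then show "g = act (affine_points W) (b - a)"
      using w(2) by (metis add_diff_cancel_left')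
  qed
qed

text \<open>A shear fixes \<open>W\<close> pointwise, so the image of a line has the same point at
  infinity. The opposite shear provides preimages of lines.\<close>

lemma act_automorphism:
  assumes "\<And>p. p \<in> H \<Longrightarrow> p \<subseteq> W" "w \<in> W"
  shows "act (affine_points W) w \<in> geometry_automorphisms (affine_points W) (T2star_lines W H)"
proof -
  let ?A = "affine_points W" and ?L = "T2star_lines W H"
  have line: "act ?A w ` {p \<in> ?A. p \<subseteq> l} = {p \<in> ?A. p \<subseteq> shear w ` l}" if "w \<in> W" for w l
  proof (intro subset_antisym subsetI)
    fix p assume "p \<in> act ?A w ` {p \<in> ?A. p \<subseteq> l}"
    then show "p \<in> {p \<in> ?A. p \<subseteq> shear w ` l}"
      using shear_affine_points[OF that] by (auto simp: act_def)
  next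
    fix p assume p: "p \<in> {p \<in> ?A. p \<subseteq> shear w ` l}"
    have "shear (- w) ` p \<subseteq> shear (- w) ` shear w ` l"
      using p by blast
    then have "shear (- w) ` p \<in> {p \<in> ?A. p \<subseteq> l}"
      using p that shear_affine_points[of "- w" p] by (simp add: shear_image_image shear_0 W_closed)
    moreover have "p = act ?A w (shear (- w) ` p)"
      using calculation that by (simp add: act_def shear_image_image shear_0 W_closed)
    ultimately show "p \<in> act ?A w ` {p \<in> ?A. p \<subseteq> l}"
      by blast
  qed
  have sub: "act ?A w ` k \<in> ?L" if w: "w \<in> W" and "k \<in> ?L" for w k
  proof -
    obtain l where l: "k = {p \<in> ?A. p \<subseteq> l}" "l \<in> proj_lines" "l \<inter> W \<in> H"
      using \<open>k \<in> ?L\<close> unfolding T2star_lines_def by blast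
    have "vec.subspace (shear w ` l)" "vec.dim (shear w ` l) = 2"
      using l(2) bij_is_inj[OF bij_shear[OF w]] linmap_shear
      by (auto simp: proj_lines_def vec.linear_subspace_image vec.dim_image_eq inj_on_subset)
    then have "shear w ` l \<in> proj_lines"
      by (simp add: proj_lines_def)
    moreover have "x \<in> shear w ` l \<longleftrightarrow> x \<in> l" if "x \<in> W" for x
    proof
      assume "x \<in> shear w ` l"
      then obtain z where z: "x = shear w z" "z \<in> l"
        by blast
      then have "z \<in> W"
        using that \<phi>_shear[OF w, of z] by (simp add: W_eq)
      then show "x \<in> l"
        using z shear_W by simp
    next
      assume "x \<in> l"
      then show "x \<in> shear w ` l"
        using shear_W[OF that, of w] by (metis imageI)
    qed
    then have "shear w ` l \<inter> W = l \<inter> W"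
      by blast
    ultimately show ?thesis
      unfolding l(1) line[OF w] T2star_lines_def using l(3) by auto
  qed
  have "(\<lambda>l. act ?A w ` l) ` ?L = ?L"
  proof (intro subset_antisym subsetI)
    fix k assume k: "k \<in> ?L"
    then have "k \<subseteq> ?A"
      by (auto simp: T2star_lines_def)
    then have "act ?A w ` act ?A (- w) ` k = k"
      using act_act[of ?A "- w" _ w] act_0[of ?A] shear_affine_points assms(2)
      by (force simp: image_image W_closed subset_iff image_iff)
    moreover have "act ?A (- w) ` k \<in> ?L"
      using sub k assms(2) by (simp add: W_closed)
    ultimately show "k \<in> (\<lambda>l. act ?A w ` l) ` ?L"
      by (metis imageI)
  qed (use sub assms(2) in auto)
  then show ?thesis
    using act_Bij[OF shear_affine_points assms(2)] by (simp add: geometry_automorphisms_def)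
qed

text \<open>The required subgroup of \<open>PGL\<close> consists of the shears acting on all points;
  it fixes each point of \<open>W\<close>, hence \<open>H\<close>.\<close>

lemma linear_singer_group_translations:
  assumes "H \<subseteq> {p \<in> proj_points. p \<subseteq> W}"
  shows "linear_singer_group W H (translation_group W)"
proof -
  let ?A = "affine_points W" and ?K = "act proj_points ` W"
  have H: "p \<in> proj_points \<and> p \<subseteq> W" if "p \<in> H" for p
    using assms that by blast
  have fix_W: "act proj_points w p = p" if "p \<in> proj_points" "p \<subseteq> W" for w p
    using that shear_W by (auto simp: act_def subset_iff image_iff)
  have "singer_group ?A (T2star_lines W H) (translation_group W)"
    unfolding singer_group_def using sharply_transitive_translations
      subgroup_act[of ?A, OF shear_affine_points] act_automorphism[of H] H
    by (auto simp: translation_group_eq)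
  moreover have "subgroup ?K (BijGroup proj_points)"
    by (rule subgroup_act[OF shear_proj_points])
  moreover have "?K \<subseteq> PGL"
    using linmap_shear bij_shear unfolding PGL_def act_def by blast
  moreover have "\<forall>g\<in>?K. g ` {p \<in> proj_points. p \<subseteq> W} = {p \<in> proj_points. p \<subseteq> W} \<and> g ` H = H"
    using fix_W H by (force simp: image_iff)
  moreover have "translation_group W = (\<lambda>g. restrict g ?A) ` ?K"
    by (auto simp: translation_group_eq act_def affine_points_def image_image restrict_def fun_eq_iff intro!: image_cong)
  ultimately show ?thesis
    unfolding linear_singer_group_def by blast
qed

text \<open>Splitting vectors as \<open>c *s e + w\<close> shows that q times the size of
  \<open>W\<close> is q^4.\<close>

lemma card_W: "card W = CARD('a) ^ 3"
proof -
  have "bij_betw (\<lambda>(c, w). c *s e + w) (UNIV \<times> W) (UNIV :: ('a ^ 4) set)"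
    by (rule bij_betw_byWitness[where f' = "\<lambda>x. (\<phi> x, x - \<phi> x *s e)"])
      (auto simp: W_eq \<phi>_add \<phi>_diff \<phi>_scale \<phi>_e)
  from bij_betw_same_card[OF this] have "CARD('a) * card W = CARD('a) ^ 4"
    by (simp add: card_cartesian_product)
  then have "CARD('a) * card W = CARD('a) * CARD('a) ^ 3"
    by (simp add: numeral_eq_Suc)
  then show ?thesis
    by simp
qed

end

section \<open>Linear Singer groups\<close>

lemma funpow_image: "(f ^^ n) ` (f ` U) = (f ^^ Suc n) ` U"
  by (simp only: image_comp funpow_Suc_right)

text \<open>Transfers the finite order of a group element to iterates of the linear map that induces
  it.\<close>

lemma BijGroup_pow_apply:
  assumes "subgroup G (BijGroup S)" "g \<in> G" "\<And>p. p \<in> S \<Longrightarrow> g p = f ` p" "p \<in> S"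
  shows "(g [^]\<^bsub>BijGroup S\<lparr>carrier := G\<rparr>\<^esub> n) p = (f ^^ n) ` p"
  using assms(4)
proof (induction n arbitrary: p)
  case 0
  then show ?case
    by (simp add: BijGroup_def)
next
  case (Suc n)
  let ?B = "BijGroup S\<lparr>carrier := G\<rparr>"
  interpret group ?B
    by (rule subgroup.subgroup_is_group[OF assms(1) group_BijGroup])
  have sub: "G \<subseteq> Bij S"
    using subgroup.subset[OF assms(1)] by (simp add: BijGroup_def)
  have "g [^]\<^bsub>?B\<^esub> n \<in> G"
    using nat_pow_closed[of g n] assms(2) by simp
  then have "(g [^]\<^bsub>?B\<^esub> Suc n) p = (g [^]\<^bsub>?B\<^esub> n) (g p)"
    using sub assms(2) Suc.prems by (simp add: BijGroup_def compose_def subset_iff)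
  also have "\<dots> = (f ^^ n) ` (g p)"
    using Suc.IH[of "g p"] sub assms(2) Suc.prems Bij_imp_funcset by blast
  also have "\<dots> = (f ^^ Suc n) ` p"
    by (simp only: assms(3)[OF Suc.prems] funpow_image)
  finally show ?case .
qed

lemma sharply_transitive_card:
  assumes "sharply_transitive G S" "S \<noteq> {}" "\<And>g p. g \<in> G \<Longrightarrow> p \<in> S \<Longrightarrow> g p \<in> S"
  shows "card G = card S"
proof -
  obtain p where p: "p \<in> S"
    using assms(2) by blast
  have "bij_betw (\<lambda>g. g p) G S"
    unfolding bij_betw_def
  proof
    show "inj_on (\<lambda>g. g p) G"
      using assms(1,3) p unfolding sharply_transitive_def inj_on_def by metis
    show "(\<lambda>g. g p) ` G = S"
    proof (intro subset_antisym subsetI)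
      fix y assume "y \<in> S"
      then show "y \<in> (\<lambda>g. g p) ` G"
        using assms(1) p unfolding sharply_transitive_def by blast
    qed (use assms(3) p in blast)
  qed
  then show ?thesis
    by (rule bij_betw_same_card)
qed

text \<open>Given \<open>t\<close> in \<open>T\<close>, some element of \<open>G\<close> agrees with
  it at one point; both lie in \<open>T\<close>, so they coincide.\<close>

lemma sharply_transitive_subset_eq:
  assumes "sharply_transitive G S" "sharply_transitive T S" "G \<subseteq> T" "S \<noteq> {}" "\<And>t p. t \<in> T \<Longrightarrow> p \<in> S \<Longrightarrow> t p \<in> S"
  shows "G = T"
proof
  show "T \<subseteq> G"
  proof
    fix t assume t: "t \<in> T"
    obtain p where p: "p \<in> S"
      using assms(4) by blast
    then have tp: "t p \<in> S"
      using assms(5) t by blast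
    then obtain g where g: "g \<in> G" "g p = t p"
      using assms(1) p unfolding sharply_transitive_def by blast
    then have "g = t"
      using assms(2,3) p t tp unfolding sharply_transitive_def by blast
    then show "t \<in> G"
      using g(1) by simp
  qed
qed fact

context hyperoval_in_plane
begin

text \<open>Among the repeated squares of \<open>s\<close>, the last one different from
  \<open>id\<close> is an involution.\<close>

lemma exists_involution:
  assumes "s \<in> lin_perms" "s ^^ (2 ^ j) = id" "s \<noteq> id"
  shows "\<exists>r. involution r"
  using assms(2)
proof (induction j)
  case 0
  moreover have "s ^^ (2 ^ 0) = s"
    by simp
  ultimately show ?case
    using assms(3) by metis
next
  case (Suc j)
  let ?r = "s ^^ (2 ^ j)"
  have "?r \<circ> ?r = id"
    using Suc.prems by (simp only: power_Suc mult_2 funpow_add)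
  then show ?case
    using Suc.IH funpow_in_lin_perms[OF assms(1), of "2 ^ j"] unfolding involution_def by blast
qed

end

section \<open>Every linear Singer group consists of translations\<close>

locale T2star = hyperoval_in_plane W H h + affine_chart W \<phi> e
  for W :: "('a::{field,finite} ^ 4) set" and H h \<phi> e
begin

lemma linear_singer_group_subset:
  assumes G: "linear_singer_group W H G" and no_inv: "\<And>s. \<not> involution s"
  shows "G \<subseteq> translation_group W"
proof
  fix g assume "g \<in> G"
  let ?A = "affine_points W"
  have sub: "subgroup G (BijGroup ?A)" and trans: "sharply_transitive G ?A"
    using G by (auto simp: linear_singer_group_def singer_group_def)
  from G obtain K where K: "K \<subseteq> PGL" "G = (\<lambda>g. restrict g ?A) ` K"
    and K_stab: "\<forall>k\<in>K. k ` {p \<in> proj_points. p \<subseteq> W} = {p \<in> proj_points. p \<subseteq> W} \<and> k ` H = H"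
    unfolding linear_singer_group_def by (elim conjE exE) (rule that)
  obtain k where k: "k \<in> K" "g = restrict k ?A"
    using K(2) \<open>g \<in> G\<close> by blast
  have kW: "k ` {p \<in> proj_points. p \<subseteq> W} = {p \<in> proj_points. p \<subseteq> W}" and k_H: "k ` H = H"
    using K_stab k(1) by auto
  obtain f where f: "linmap f" "k = (\<lambda>U\<in>proj_points. f ` U)"
    using K(1) k(1) unfolding PGL_def by blast
  have A_sub: "p \<in> ?A \<Longrightarrow> p \<in> proj_points" for p
    by (simp add: affine_points_def)
  have gA: "g p = f ` p" if "p \<in> ?A" for p
    using that A_sub by (simp add: k(2) f(2))
  have fW: "f y \<in> W" if "y \<in> W" for y
  proof (cases "y = 0")
    case True
    then show ?thesis
      using linmapD(2)[OF f(1), of 0 y] W_closed(1) by simp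
  next
    case False
    then have "pt y \<in> {p \<in> proj_points. p \<subseteq> W}"
      using that by (simp add: pt_in_proj_points_iff pt_subset_iff[OF subspace_W])
    then have "k (pt y) \<subseteq> W"
      using kW by blast
    then show ?thesis
      using False self_mem_pt[of y] by (auto simp: f(2) pt_in_proj_points_iff)
  qed
  have kH: "k p = f ` p" if "p \<in> H" for p
    using that points by (auto simp: f(2))
  have fH: "(`) f ` H = H"
    using k_H kH by simp
  define s where "s p = (if p \<in> H then f ` p else p)" for p
  have s: "s \<in> lin_perms"
    unfolding s_def using f(1) fH by (intro lin_permsI finite_surj_inj) auto
  have sn: "(s ^^ n) p = (f ^^ n) ` p" if "p \<in> H" for n p
    using that
  proof (induction n arbitrary: p)
    case (Suc n)
    have "s p \<in> H"
      using Suc.prems lin_perms_permutes[OF s] by (simp add: permutes_in_image)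
    then have "(s ^^ Suc n) p = (f ^^ n) ` (s p)"
      using Suc.IH by (simp only: funpow_Suc_right comp_apply)
    also have "s p = f ` p"
      using Suc.prems by (simp add: s_def)
    finally show ?case
      by (simp only: funpow_image)
  qed simp
  \<comment> \<open>\<open>N\<close> plays two parts: as the order of \<open>G\<close> it makes
    \<open>f ^^ N\<close> fix all affine points, and as a power of q it satisfies
    \<open>x ^ N = x\<close> in the field.\<close>
  define N where "N = CARD('a) ^ 3"
  have "pt (e + 0) \<in> ?A"
    using mem_affine_points_iff W_closed(1) by blast
  then have ne: "?A \<noteq> {}"
    by blast
  have "G \<subseteq> Bij ?A"
    using subgroup.subset[OF sub] by (simp add: BijGroup_def)
  then have "card G = card ?A"
    using Bij_imp_funcset by (intro sharply_transitive_card[OF trans ne]) blast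
  also have "\<dots> = N"
    using bij_betw_same_card[OF bij_betw_affine_points] card_W by (simp add: N_def)
  finally have N: "N = Coset.order (BijGroup ?A\<lparr>carrier := G\<rparr>)"
    by (simp add: Coset.order_def)
  have gN: "g [^]\<^bsub>BijGroup ?A\<lparr>carrier := G\<rparr>\<^esub> N = \<one>\<^bsub>BijGroup ?A\<lparr>carrier := G\<rparr>\<^esub>"
    unfolding N using \<open>g \<in> G\<close>
    by (intro group.pow_order_eq_1 subgroup.subgroup_is_group[OF sub group_BijGroup]) simp
  define F where "F = f ^^ N"
  have F: "linmap F"
    unfolding F_def by (rule linmap_funpow[OF f(1)])
  have F_fix: "F ` p = p" if "p \<in> ?A" for p
    using BijGroup_pow_apply[OF sub \<open>g \<in> G\<close> gA that, of N] that unfolding gN F_def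
    by (simp add: BijGroup_def)
  have fnW: "(f ^^ n) y \<in> W" if "y \<in> W" for n y
    using that by (induction n) (simp_all add: fW)
  have eig: "\<exists>c. F (e + y) = c *s (e + y)" if "y \<in> W" for y
    using F_fix linmap_pt_fixedE[OF F, of "e + y" "e + y"] that mem_affine_points_iff by metis
  obtain c where c: "F e = c *s e"
    using eig[OF W_closed(1)] by auto
  \<comment> \<open>Each \<open>e + y\<close> is an eigenvector of \<open>F\<close>; comparing
    values of \<open>\<phi>\<close> shows that its eigenvalue is that of \<open>e\<close>, so
    \<open>F\<close> is scalar.\<close>
  have Fc: "F y = c *s y" if y: "y \<in> W" for y
  proof -
    obtain d where d: "F (e + y) = d *s (e + y)"
      using eig[OF y] by blast
    then have eq: "c *s e + F y = d *s e + d *s y"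
      by (simp add: linmapD[OF F] c vector_add_ldistrib)
    have "F y \<in> W"
      using fnW[OF y] by (simp add: F_def)
    then have "\<phi> (c *s e + F y) = c" "\<phi> (d *s e + d *s y) = d"
      using y by (simp_all add: \<phi>_add \<phi>_scale \<phi>_e \<phi>_W)
    then have "c = d"
      using eq by simp
    then show ?thesis
      using eq by simp
  qed
  have "(s ^^ N) p = p" for p
  proof (cases "p \<in> H")
    case True
    obtain x where x: "p = pt x" "x \<in> W" "x \<noteq> 0"
      by (rule H_cases[OF True])
    have Fp: "F ` p = pt (c *s x)"
      using x by (simp add: linmap_pt[OF F] Fc)
    have "(s ^^ N) p \<in> H"
      using True funpow_in_lin_perms[OF s] lin_perms_permutes permutes_in_image by metis
    then have "c \<noteq> 0"
      using sn[OF True, of N] ptH_D(2) Fp unfolding F_def by fastforce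
    then show ?thesis
      using sn[OF True, of N] Fp x(1) pt_scale unfolding F_def by metis
  next
    case False
    then show ?thesis
      using lin_perms_permutes[OF funpow_in_lin_perms[OF s]] permutes_not_in by metis
  qed
  then have "s ^^ (2 ^ (h * 3)) = id"
    by (auto simp: N_def card_field power_mult)
  then have "s = id"
    using exists_involution[OF s] no_inv by blast
  then have fix_H: "f ` p = p" if "p \<in> H" for p
    using that by (metis id_apply s_def)
  have "card H \<ge> 4"
    using card_H card_field_ge_2[where 'a='a] by simp
  then have "\<exists>d. d \<noteq> 0 \<and> (\<forall>y\<in>W. f y = d *s y)"
    by (rule scalar_if_fixes_4_points[OF f(1) subset_refl _ fix_H]) blast+
  then obtain d where d: "d \<noteq> 0" "\<And>y. y \<in> W \<Longrightarrow> f y = d *s y"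
    by blast
  have f_eq: "f x = \<phi> x *s f e + d *s (x - \<phi> x *s e)" for x
  proof -
    have "x - \<phi> x *s e \<in> W"
      by (simp add: W_eq \<phi>_diff \<phi>_scale \<phi>_e)
    then have "f (\<phi> x *s e + (x - \<phi> x *s e)) = \<phi> x *s f e + d *s (x - \<phi> x *s e)"
      by (simp only: linmapD[OF f(1)] d(2))
    then show ?thesis
      by simp
  qed
  \<comment> \<open>\<open>f\<close> acts as \<open>d\<close> on \<open>W\<close> and multiplies
    \<open>\<phi>\<close> by \<open>\<phi> (f e)\<close>. Both scalars equal their
    \<open>N\<close>-th powers, and these are the single eigenvalue \<open>c\<close> of
    \<open>F\<close>, so the two scalars coincide.\<close>
  have \<phi>f: "\<phi> (f x) = \<phi> (f e) * \<phi> x" for x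
    unfolding f_eq[of x] by (simp add: \<phi>_add \<phi>_diff \<phi>_scale \<phi>_e)
  have "\<phi> ((f ^^ n) e) = \<phi> (f e) ^ n" for n
  proof (induction n)
    case (Suc n)
    then show ?case
      using \<phi>f[of "(f ^^ n) e"] by simp
  qed (simp add: \<phi>_e)
  then have "\<phi> (F e) = \<phi> (f e)"
    unfolding F_def N_def by (simp only: finite_field_power_card_power)
  then have "\<phi> (f e) = c"
    by (simp add: c \<phi>_scale \<phi>_e)
  moreover have "c = d"
  proof -
    obtain p where "p \<in> H"
      using card_H by fastforce
    then obtain x where x: "x \<in> W" "x \<noteq> 0"
      by (rule H_cases)
    have "(f ^^ n) x = d ^ n *s x" for n
      by (induction n) (simp_all add: linmapD[OF f(1)] d(2) x(1) mult.commute)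
    then have "c *s x = d *s x"
      using Fc[OF x(1)] unfolding F_def N_def by (simp only: finite_field_power_card_power)
    then show ?thesis
      using x(2) by simp
  qed
  ultimately have \<phi>d: "\<phi> (f e) = d"
    by simp
  \<comment> \<open>Dividing \<open>f\<close> by the common scalar \<open>d\<close> leaves a map
    that is the identity on \<open>W\<close> and preserves \<open>\<phi>\<close>, hence the shear by
    this \<open>w\<close>.\<close>
  define w where "w = (1 / d) *s f e - e"
  have w: "w \<in> W"
    unfolding W_eq using d(1) \<phi>d by (simp add: w_def \<phi>_diff \<phi>_scale \<phi>_e)
  have fs: "f x = d *s shear w x" for x
    using d(1) unfolding f_eq[of x] by (simp add: shear_def w_def vec_eq_iff field_simps)
  have "f ` p = shear w ` p" if p: "p \<in> ?A" for p
  proof -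
    obtain y where "p = pt (e + y)"
      using p mem_affine_points_iff by blast
    then show ?thesis
      by (simp only: linmap_pt[OF f(1)] linmap_pt[OF linmap_shear] fs[of "e + y"] pt_scale[OF d(1)])
  qed
  then have "g = act ?A w"
    unfolding act_def using gA by (simp add: k(2) restrict_def fun_eq_iff)
  then show "g \<in> translation_group W"
    using w by (simp add: translation_group_eq)
qed

text \<open>Both groups are sharply transitive on the affine points, so the inclusion already proved
  is an equality.\<close>

lemma linear_singer_group_iff:
  assumes "\<And>s. \<not> involution s"
  shows "linear_singer_group W H G \<longleftrightarrow> G = translation_group W"
proof
  assume G: "linear_singer_group W H G"
  have "pt (e + 0) \<in> affine_points W"
    using mem_affine_points_iff W_closed(1) by blast
  then have "affine_points W \<noteq> {}"
    by blast
  moreover have "sharply_transitive G (affine_points W)"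
    using G by (simp add: linear_singer_group_def singer_group_def)
  ultimately show "G = translation_group W"
    using linear_singer_group_subset[OF G assms] act_in[OF shear_affine_points]
    by (intro sharply_transitive_subset_eq[OF _ sharply_transitive_translations])
      (auto simp: translation_group_eq)
qed (use linear_singer_group_translations points in simp)

lemma elementary_abelian_translations:
  "elementary_abelian 2 (BijGroup (affine_points W)\<lparr>carrier := translation_group W\<rparr>)"
proof -
  let ?A = "affine_points W"
  let ?B = "BijGroup ?A\<lparr>carrier := translation_group W\<rparr>"
  note mult = act_mult[of ?A, OF shear_affine_points]
  have "subgroup (translation_group W) (BijGroup ?A)"
    unfolding translation_group_eq by (rule subgroup_act[OF shear_affine_points])
  then interpret group ?B
    by (rule subgroup.subgroup_is_group[OF _ group_BijGroup])
  have "comm_group ?B"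
    by (rule group_comm_groupI) (auto simp: translation_group_eq mult add.commute)
  moreover have "x [^]\<^bsub>?B\<^esub> (2::nat) = \<one>\<^bsub>?B\<^esub>" if x: "x \<in> carrier ?B" for x
  proof -
    obtain w where w: "w \<in> W" "x = act ?A w"
      using x by (auto simp: translation_group_eq)
    have "w + w = 0"
      by (simp add: vec_eq_iff two_eq_0)
    then have "x \<otimes>\<^bsub>?B\<^esub> x = \<one>\<^bsub>?B\<^esub>"
      using w act_one[of ?A, OF shear_affine_points] by (simp add: mult)
    then show ?thesis
      using l_one[OF x] by (simp only: numeral_2_eq_2 nat_pow_Suc nat_pow_0)
  qed
  ultimately show ?thesis
    by (simp add: elementary_abelian_def)
qed

lemma card_translation_group: "card (translation_group W) = CARD('a) ^ 3"
proof -
  have "pt (e + 0) \<in> affine_points W"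
    using mem_affine_points_iff W_closed(1) by blast
  then have "card (translation_group W) = card (affine_points W)"
    using act_in[OF shear_affine_points]
    by (intro sharply_transitive_card[OF sharply_transitive_translations]) (auto simp: translation_group_eq)
  then show ?thesis
    using bij_betw_same_card[OF bij_betw_affine_points] card_W by simp
qed

end

theorem mainTheorem10:
  fixes W :: "('a::{field,finite} ^ 4) set"
    and H :: "('a ^ 4) set set"
    and h :: nat
  assumes "CARD('a) = 2 ^ h"
    and "W \<in> proj_planes"
    and "monomial_hyperoval W H"
    and "\<not> translation_hyperoval W H"
  shows "elementary_abelian 2 (BijGroup (affine_points W)\<lparr>carrier := translation_group W\<rparr>)
    \<and> card (translation_group W) = CARD('a) ^ 3
    \<and> (\<forall>G. linear_singer_group W H G \<longleftrightarrow> G = translation_group W)"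
proof -
  obtain \<phi> e where chart: "affine_chart W \<phi> e"
    using affine_chart_exists[OF assms(2)] by blast
  have H: "hyperoval W H"
    using assms(3) unfolding monomial_hyperoval_def by (rule conjunct1)
  have "hyperoval_in_plane W H h"
  proof
    show "vec.subspace W" "vec.dim W = 3"
      using assms(2) by (simp_all add: proj_planes_def)
    note H' = H[unfolded hyperoval_def]
    show "H \<subseteq> {p \<in> proj_points. p \<subseteq> W}"
      by (rule H'[THEN conjunct1])
    show "card H = CARD('a) + 2"
      by (rule H'[THEN conjunct2, THEN conjunct1])
    show "\<not> (\<exists>l\<in>proj_lines. p \<subseteq> l \<and> r \<subseteq> l \<and> s \<subseteq> l)"
      if "p \<in> H" "r \<in> H" "s \<in> H" "p \<noteq> r" "p \<noteq> s" "r \<noteq> s" for p r s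
      by (rule H'[THEN conjunct2, THEN conjunct2, THEN bspec, OF that(1), THEN bspec, OF that(2),
          THEN bspec, OF that(3), THEN mp, OF conjI[OF that(4) conjI[OF that(5,6)]]])
  qed fact
  then interpret T2star W H h \<phi> e
    using chart by (rule T2star.intro)
  have "\<exists>m. proj_equivalent W H (monomial_set m)"
    using assms(3) unfolding monomial_hyperoval_def by (rule conjunct2)
  then obtain m where m: "proj_equivalent W H (monomial_set m)" ..
  have "\<exists>u v w. frame m u v w"
    using proj_equivalent_iff_frame[OF exponent_pos[OF m]] m by (rule iffD1)
  then obtain u v w where frame: "frame m u v w"
    by (elim exE)
  have no_inv: "\<not> involution s" for s
  proof
    assume "involution s"
    then have additive_frame
      by (rule additive_frame_if_involution[OF frame])
    then obtain k where k: "coprime k h" "proj_equivalent W H (monomial_set (2 ^ k))"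
      by (rule translation_if_additive_frame)
    have "translation_hyperoval W H"
      unfolding translation_hyperoval_def by (intro conjI H exI[of _ h] exI[of _ k] assms(1) k)
    with assms(4) show False ..
  qed
  show ?thesis
    by (intro conjI allI elementary_abelian_translations card_translation_group
        linear_singer_group_iff no_inv)
qed

end
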